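(* Let $n\ge2$ and $s\ge1$ be fixed integers. As $H\to\infty$, $$\#\mathcal{G}_{n,s}(H)\le H^{sn^2-(s-1)n/3+o(1)}.$$
   Context: $\mathcal{M}_n(\mathbb{Z};H)$ is the set of $n\times n$ matrices with integer entries of absolute value at most $H$. $\mathcal{G}_{n,s}(H)$ is the set of $s$-tuples $(A_1,\dots,A_s)\in\mathcal{M}_n(\mathbb{Z};H)^s$ of non-singular matrices such that the set $$\langle A_1\rangle\cdots\langle A_s\rangle=\{A_1^{k_1}\cdots A_s^{k_s}:\ k_1,\dots,k_s\in\mathbb{Z}\}$$ (products in this order) is a subgroup of $\mathrm{GL}_n(\mathbb{Q})$. Here $o(1)$ is a quantity tending to $0$ as $H\to\infty$ with $n,s$ fixed. *)

theory Defs
  imports "Jordan_Normal_Form.Determinant" "HOL-Algebra.Group"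
begin

definition int_mats :: "nat \<Rightarrow> real \<Rightarrow> int mat set" where
  "int_mats n H = {A \<in> carrier_mat n n. \<forall>i<n. \<forall>j<n. \<bar>real_of_int (A $$ (i, j))\<bar> \<le> H}"

definition GL_rat :: "nat \<Rightarrow> rat mat monoid" where
  "GL_rat n = units_of (ring_mat TYPE(rat) n ())"

(* Both lists have the same length s, so the elements of the set are
   A_1^{k_1} (A_2^{k_2} (... (A_s^{k_s} 1))), in this order. *)
definition cyclic_prod :: "('a, 'b) monoid_scheme \<Rightarrow> 'a list \<Rightarrow> 'a set" where
  "cyclic_prod G As =
     {foldr (\<otimes>\<^bsub>G\<^esub>) (map2 (\<lambda>A k. A [^]\<^bsub>G\<^esub> k) As ks) \<one>\<^bsub>G\<^esub> | ks :: int list. length ks = length As}"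

definition group_tuples :: "nat \<Rightarrow> nat \<Rightarrow> real \<Rightarrow> int mat list set" where
  "group_tuples n s H =
     {As. length As = s \<and>
          (\<forall>A \<in> set As. A \<in> int_mats n H \<and> det A \<noteq> 0) \<and>
          subgroup (cyclic_prod (GL_rat n) (map (map_mat rat_of_int) As)) (GL_rat n)}"

end

theory Submission
  imports Defs "HOL-Computational_Algebra.Primes" "HOL-Computational_Algebra.Polynomial"
begin

text \<open>
  Write \<open>d\<^sub>l = det A\<^sub>l\<close>, and choose a multiplicative relation between the \<open>d\<^sub>l\<close> with the largest
  possible support \<open>S\<close>; then every relation is supported in \<open>S\<close>. The primes on the two sides of the chosen
  relation coincide, so there is \<open>T \<subseteq> S\<close> with \<open>2 |T| \<le> |S|\<close> such that every prime dividing some \<open>d\<^sub>l\<close>,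
  \<open>l \<in> S\<close>, divides \<open>K = \<Prod>\<^sub>T d\<^sub>l\<close>. If \<open>j \<notin> S\<close>, the commutator of \<open>A\<^sub>j\<close> with any \<open>B = A\<^sub>i\<close> lies in the product set and has
  determinant 1, so it is a product of powers of the \<open>A\<^sub>l\<close> with \<open>l \<in> S\<close>, and its denominators involve only
  primes dividing \<open>K\<close>. Hence every prime dividing \<open>d\<^sub>j\<close> divides \<open>K\<close> times each entry of \<open>A\<^sub>j B adj A\<^sub>j\<close>.

  An off-diagonal entry \<open>(p, q)\<close> of \<open>A B adj A\<close> does not depend on row \<open>q\<close> of \<open>A\<close>. If it is nonzero, the other
  rows of \<open>A\<close> leave only \<open>H powr o(1)\<close> values for \<open>det A\<close>, and a lattice point count (dyadically over the
  primitive vector orthogonal to the other rows) gives \<open>H powr (n\<^sup>2 - n + o(1))\<close> such matrices. If all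
  off-diagonal entries vanish, the rows of \<open>A\<close> are left eigenvectors of \<open>B\<close>, which for non-scalar \<open>B\<close> again
  loses a factor \<open>H\<close> per row. So all matrices outside \<open>T \<union> {i}\<close> cost \<open>n\<^sup>2 - n + o(1)\<close>; when \<open>S\<close> is everything,
  the index \<open>i\<close> is not needed. In both cases at least \<open>(s - 1) / 2\<close> matrices lose a factor \<open>H powr n\<close>.
\<close>

section \<open>Integers supported on given primes\<close>

text \<open>Rankin's trick: each counted \<open>x\<close> has \<open>1 \<le> (X / x) powr e\<close>,
  and the sum of \<open>x powr - e\<close> over the integers supported on \<open>P\<close> is an
  Euler product. The induction adds one prime at a time, so that only geometric sums occur.\<close>

lemma card_supported_on_primes_le:
  fixes e X :: real and P :: "nat set"
  assumes "e > 0" "finite P" "\<And>p. p \<in> P \<Longrightarrow> prime p" "X \<ge> 0"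
  shows "finite {x. 0 < x \<and> real x \<le> X \<and> prime_factors x \<subseteq> P}"
    and "real (card {x. 0 < x \<and> real x \<le> X \<and> prime_factors x \<subseteq> P})
           \<le> X powr e * (\<Prod>p\<in>P. 1 / (1 - real p powr - e))"
proof -
  define S where "S = (\<lambda>P X. {x::nat. 0 < x \<and> real x \<le> X \<and> prime_factors x \<subseteq> P})"
  have fin: "finite (S P X)" for P X
  proof (rule finite_subset)
    show "S P X \<subseteq> {..nat \<lceil>X\<rceil>}" unfolding S_def by (auto simp: le_nat_iff) linarith
  qed simp
  then show "finite {x. 0 < x \<and> real x \<le> X \<and> prime_factors x \<subseteq> P}" unfolding S_def .
  have "\<forall>X\<ge>0. real (card (S P X)) \<le> X powr e * (\<Prod>p\<in>P. 1 / (1 - real p powr - e))"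
    using assms(2,3)
  proof (induction P rule: finite_induct)
    case empty
    show ?case
    proof (intro allI impI)
      fix X :: real assume "X \<ge> 0"
      have "S {} X \<subseteq> {1}" unfolding S_def by (auto simp: prime_factorization_empty_iff)
      show "real (card (S {} X)) \<le> X powr e * (\<Prod>p\<in>{}. 1 / (1 - real p powr - e))"
      proof (cases "X \<ge> 1")
        case True
        have "card (S {} X) \<le> 1" using card_mono[OF _ \<open>S {} X \<subseteq> {1}\<close>] by simp
        moreover have "X powr e \<ge> 1" using True assms(1) by (simp add: ge_one_powr_ge_zero)
        ultimately show ?thesis by simp
      next
        case False
        then have "S {} X = {}" unfolding S_def by auto
        then show ?thesis by simp
      qed
    qed
  next
    case (insert q P)
    have q: "prime q" using insert by auto
    then have q2: "real q \<ge> 2" using prime_ge_2_nat[of q] by linarith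
    define r where "r = real q powr - e"
    have r: "0 < r" "r < 1" unfolding r_def using q2 assms(1) by (auto intro: powr_less_one)
    define D where "D = (\<Prod>p\<in>P. 1 / (1 - real p powr - e))"
    have D0: "D \<ge> 0" unfolding D_def
    proof (intro prod_nonneg ballI)
      fix p assume "p \<in> P"
      then have "prime p" using insert by auto
      then have "real p \<ge> 2" using prime_ge_2_nat[of p] by linarith
      then have "real p powr - e < 1" using assms(1) by (intro powr_less_one) auto
      then show "0 \<le> 1 / (1 - real p powr - e)" by simp
    qed
    have IH: "real (card (S P Y)) \<le> Y powr e * D" if "Y \<ge> 0" for Y
      using insert that unfolding D_def by auto
    show ?case
    proof (intro allI impI)
      fix X :: real assume X: "X \<ge> 0"
      \<comment> \<open>A crude bound for the exponent of \<open>q\<close>, since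
        \<open>a < 2 ^ a \<le> q ^ a \<le> x \<le> X\<close>.\<close>
      define m where "m = nat \<lceil>X\<rceil>"
      \<comment> \<open>Split off the exact power of \<open>q\<close>: the remaining factor is prime
        to \<open>q\<close>, hence supported on \<open>P\<close>, and at most
        \<open>X / q ^ a\<close>.\<close>
      have sub: "S (insert q P) X \<subseteq> (\<Union>a\<in>{..m}. (\<lambda>y. q ^ a * y) ` S P (X / real (q ^ a)))"
      proof
        fix x assume x: "x \<in> S (insert q P) X"
        define a where "a = multiplicity q x"
        obtain y where y: "x = q ^ a * y" using multiplicity_dvd[of q x] unfolding a_def by (elim dvdE)
        have x0: "x > 0" using x unfolding S_def by auto
        have nq: "\<not> q dvd y"
        proof
          assume "q dvd y"
          then have "q ^ Suc a dvd x" unfolding y by (simp add: mult.commute mult_dvd_mono)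
          then show False using x0 q unfolding a_def
            by (metis multiplicity_geI[of x q "Suc (multiplicity q x)"] not_less_eq_eq order_refl not_prime_unit gr_implies_not0)
        qed
        have "y > 0" using x0 y by (cases y) auto
        moreover have "prime_factors y \<subseteq> P"
        proof
          fix p assume "p \<in> prime_factors y"
          then have p: "prime p" "p dvd y" by (auto simp: prime_factors_dvd)
          then have "p \<in> prime_factors x" using x0 y by (auto simp: prime_factors_dvd)
          then have "p \<in> insert q P" using x unfolding S_def by auto
          moreover have "p \<noteq> q" using p nq by auto
          ultimately show "p \<in> P" by auto
        qed
        moreover have "real y \<le> X / real (q ^ a)"
        proof -
          have "real x \<le> X" using x unfolding S_def by auto
          moreover have "real (q ^ a) > 0" using q2 by simp
          ultimately show ?thesis unfolding y by (simp add: field_simps)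
        qed
        ultimately have "y \<in> S P (X / real (q ^ a))" unfolding S_def by auto
        moreover have "a \<le> m"
        proof -
          have "a < 2 ^ a" by (rule less_exp)
          also have "\<dots> \<le> q ^ a" using q prime_ge_2_nat by (intro power_mono) auto
          also have "\<dots> \<le> x" using y x0 by (intro dvd_imp_le) auto
          finally have "real a \<le> X" using x unfolding S_def by auto
          then show ?thesis unfolding m_def by linarith
        qed
        ultimately show "x \<in> (\<Union>a\<in>{..m}. (\<lambda>y. q ^ a * y) ` S P (X / real (q ^ a)))" using y by blast
      qed
      have "card (S (insert q P) X) \<le> card (\<Union>a\<in>{..m}. (\<lambda>y. q ^ a * y) ` S P (X / real (q ^ a)))"
        using fin by (intro card_mono[OF _ sub]) auto
      also have "\<dots> \<le> (\<Sum>a\<in>{..m}. card ((\<lambda>y. q ^ a * y) ` S P (X / real (q ^ a))))"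
        by (rule card_UN_le) simp
      also have "\<dots> \<le> (\<Sum>a\<in>{..m}. card (S P (X / real (q ^ a))))"
        by (intro sum_mono card_image_le fin)
      finally have "real (card (S (insert q P) X)) \<le> (\<Sum>a\<in>{..m}. real (card (S P (X / real (q ^ a)))))"
        by (simp only: of_nat_sum[symmetric] of_nat_le_iff)
      also have "\<dots> \<le> (\<Sum>a\<in>{..m}. (X / real (q ^ a)) powr e * D)"
        using X by (intro sum_mono IH) auto
      also have "\<dots> = (\<Sum>a\<in>{..m}. X powr e * D * r ^ a)"
      proof (intro sum.cong refl)
        fix a
        have "r ^ a = 1 / real (q ^ a) powr e"
          unfolding r_def using q2 by (simp add: powr_minus powr_power powr_powr powr_realpow[symmetric] field_simps)
        then show "(X / real (q ^ a)) powr e * D = X powr e * D * r ^ a"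
          using X by (simp add: powr_divide)
      qed
      also have "\<dots> = X powr e * D * (\<Sum>a\<in>{..m}. r ^ a)" by (simp add: sum_distrib_left)
      also have "\<dots> \<le> X powr e * D * (1 / (1 - r))"
      proof (intro mult_left_mono)
        have "(\<Sum>a\<in>{..m}. r ^ a) = (1 - r ^ Suc m) / (1 - r)" using r by (simp add: sum_gp_basic field_simps sum_gp0)
        also have "\<dots> \<le> 1 / (1 - r)" using r by (intro divide_right_mono) auto
        finally show "(\<Sum>a\<in>{..m}. r ^ a) \<le> 1 / (1 - r)" .
      qed (use D0 in auto)
      also have "\<dots> = X powr e * (\<Prod>p\<in>insert q P. 1 / (1 - real p powr - e))"
        using insert.hyps unfolding D_def r_def by simp
      finally show "real (card (S (insert q P) X)) \<le> X powr e * (\<Prod>p\<in>insert q P. 1 / (1 - real p powr - e))" .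
    qed
  qed
  then show "real (card {x. 0 < x \<and> real x \<le> X \<and> prime_factors x \<subseteq> P})
           \<le> X powr e * (\<Prod>p\<in>P. 1 / (1 - real p powr - e))"
    using assms(4) unfolding S_def by blast
qed

text \<open>A large prime contributes at most \<open>p powr e\<close>, and the product of distinct
  primes of \<open>k\<close> is at most \<open>k\<close>. The finitely many small primes go into the
  constant \<open>C\<close>.\<close>

lemma prod_prime_factors_le:
  fixes e :: real
  assumes "e > 0"
  shows "\<exists>C\<ge>0. \<forall>k::nat. k > 0 \<longrightarrow> (\<Prod>p\<in>prime_factors k. 1 / (1 - real p powr - e)) \<le> C * real k powr e"
proof -
  \<comment> \<open>From \<open>b\<close> on, \<open>p powr e \<ge> 2\<close>, so that
    \<open>p powr e * (1 - p powr - e) = p powr e - 1 \<ge> 1\<close>.\<close>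
  define b where "b = nat \<lceil>2 powr (1 / e)\<rceil>"
  define f where "f = (\<lambda>p::nat. 1 / (1 - real p powr - e))"
  have lt1: "real p powr - e < 1" if "prime p" for p
    using prime_ge_2_nat[OF that] assms by (intro powr_less_one) auto
  have f1: "f p \<ge> 1" if "prime p" for p
    using lt1[OF that] unfolding f_def by simp
  have fle: "f p \<le> real p powr e" if p: "prime p" "p \<ge> b" for p
  proof -
    have p2: "real p \<ge> 2" using prime_ge_2_nat[OF p(1)] by linarith
    have "real p \<ge> 2 powr (1 / e)" using p(2) unfolding b_def by linarith
    then have "(2 powr (1 / e)) powr e \<le> real p powr e" using assms by (intro powr_mono2) auto
    then have ge: "real p powr e \<ge> 2" using assms by (simp add: powr_powr)
    then have "1 \<le> real p powr e * (1 - real p powr - e)"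
      using p2 by (simp add: algebra_simps powr_minus field_simps)
    then show ?thesis using lt1[OF p(1)] unfolding f_def by (simp add: field_simps)
  qed
  define C where "C = (\<Prod>p\<in>{p. prime p \<and> p < b}. f p)"
  have finb: "finite {p. prime p \<and> p < b}" by simp
  have C1: "C \<ge> 1" unfolding C_def using f1 by (intro prod_ge_1) auto
  show ?thesis
  proof (intro exI conjI allI impI)
    show "C \<ge> 0" using C1 by simp
    fix k :: nat assume k: "k > 0"
    define F where "F = prime_factors k"
    have F: "finite F" "\<And>p. p \<in> F \<Longrightarrow> prime p" unfolding F_def by auto
    have "(\<Prod>p\<in>F. f p) = (\<Prod>p\<in>F \<inter> {p. p < b}. f p) * (\<Prod>p\<in>F - {p. p < b}. f p)"
      using F by (subst prod.union_disjoint[symmetric]) (auto intro: prod.cong)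
    also have "\<dots> \<le> C * (\<Prod>p\<in>F - {p. p < b}. real p powr e)"
    proof (intro mult_mono)
      show "(\<Prod>p\<in>F \<inter> {p. p < b}. f p) \<le> C" unfolding C_def
        using F f1 by (intro prod_mono2[OF finb]) (auto intro: order_trans[OF zero_le_one])
      show "(\<Prod>p\<in>F - {p. p < b}. f p) \<le> (\<Prod>p\<in>F - {p. p < b}. real p powr e)"
        using F f1 fle by (intro prod_mono conjI) (auto intro: order_trans[OF zero_le_one])
    qed (use C1 F f1 in \<open>auto intro!: prod_nonneg intro: order_trans[OF zero_le_one]\<close>)
    also have "(\<Prod>p\<in>F - {p. p < b}. real p powr e) = (\<Prod>p\<in>F - {p. p < b}. real p) powr e"
      by (simp add: prod_powr_distrib)
    also have "C * \<dots> \<le> C * real k powr e"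
    proof (intro mult_left_mono powr_mono2)
      have "(\<Prod>p\<in>F - {p. p < b}. p) dvd (\<Prod>p\<in>F. p)"
        using F by (intro prod_dvd_prod_subset) auto
      also have "(\<Prod>p\<in>F. p) dvd (\<Prod>p\<in>F. p ^ multiplicity p k)"
        unfolding F_def by (intro prod_dvd_prod dvd_power) (auto simp: prime_factors_multiplicity)
      also have "\<dots> = k" unfolding F_def using prime_factorization_nat[OF k] by simp
      finally have "(\<Prod>p\<in>F - {p. p < b}. p) \<le> k" using k by (intro dvd_imp_le)
      then show "(\<Prod>p\<in>F - {p. p < b}. real p) \<le> real k" by (simp flip: of_nat_prod)
    qed (use C1 assms in \<open>auto intro!: prod_nonneg\<close>)
    finally show "(\<Prod>p\<in>prime_factors k. 1 / (1 - real p powr - e)) \<le> C * real k powr e"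
      unfolding F_def f_def .
  qed
qed

text \<open>Rankin's bound for the primes of \<open>K\<close>, made uniform in \<open>K\<close>: the
  Euler product costs only a power \<open>e\<close> of \<open>\<bar>K\<bar>\<close>. The two signs
  of \<open>x\<close> account for the factor 2.\<close>

lemma card_ints_supported_le:
  fixes e :: real
  assumes "e > 0"
  shows "\<exists>C\<ge>0. \<forall>X\<ge>0. \<forall>K::int. K \<noteq> 0 \<longrightarrow>
      finite {x::int. x \<noteq> 0 \<and> \<bar>real_of_int x\<bar> \<le> X \<and> (\<forall>p. prime p \<longrightarrow> p dvd x \<longrightarrow> p dvd K)} \<and>
      real (card {x::int. x \<noteq> 0 \<and> \<bar>real_of_int x\<bar> \<le> X \<and> (\<forall>p. prime p \<longrightarrow> p dvd x \<longrightarrow> p dvd K)})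
        \<le> C * (X * \<bar>real_of_int K\<bar>) powr e"
proof -
  obtain C where C: "C \<ge> 0" "\<And>k::nat. k > 0 \<Longrightarrow> (\<Prod>p\<in>prime_factors k. 1 / (1 - real p powr - e)) \<le> C * real k powr e"
    using prod_prime_factors_le[OF assms] by auto
  show ?thesis
  proof (rule exI[of _ "2 * C"], intro conjI allI impI)
    fix X :: real and K :: int assume X: "0 \<le> X" and K: "K \<noteq> 0"
    define k where "k = nat \<bar>K\<bar>"
    define N where "N = {x. 0 < x \<and> real x \<le> X \<and> prime_factors x \<subseteq> prime_factors k}"
    define Z where "Z = {x::int. x \<noteq> 0 \<and> \<bar>real_of_int x\<bar> \<le> X \<and> (\<forall>p. prime p \<longrightarrow> p dvd x \<longrightarrow> p dvd K)}"
    have k: "k > 0" using K unfolding k_def by simp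
    have N: "finite N" "real (card N) \<le> X powr e * (\<Prod>p\<in>prime_factors k. 1 / (1 - real p powr - e))"
      using card_supported_on_primes_le[OF assms, of "prime_factors k" X] X unfolding N_def by auto
    have "x \<in> int ` N \<union> (\<lambda>x. - int x) ` N" if x: "x \<in> Z" for x
    proof -
      have "nat \<bar>x\<bar> \<in> N"
        unfolding N_def
      proof (intro CollectI conjI subsetI)
        show "0 < nat \<bar>x\<bar>" "real (nat \<bar>x\<bar>) \<le> X" using x unfolding Z_def by auto
        fix p assume "p \<in> prime_factors (nat \<bar>x\<bar>)"
        then have p: "prime p" "p dvd nat \<bar>x\<bar>" by (auto simp: prime_factors_dvd)
        have "int p dvd x" using p(2) by (metis abs_ge_zero dvd_abs_iff int_dvd_int_iff int_nat_eq)
        then have "int p dvd K" using x p(1) unfolding Z_def by auto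
        then have "p dvd k" unfolding k_def by (metis abs_ge_zero dvd_abs_iff int_dvd_int_iff int_nat_eq)
        then show "p \<in> prime_factors k" using p k by (auto simp: prime_factors_dvd)
      qed
      moreover have "x = int (nat \<bar>x\<bar>) \<or> x = - int (nat \<bar>x\<bar>)" by auto
      ultimately show ?thesis by blast
    qed
    then have sub: "Z \<subseteq> int ` N \<union> (\<lambda>x. - int x) ` N" by blast
    then show "finite Z" using N(1) by (meson finite_UnI finite_imageI finite_subset)
    have "card Z \<le> card (int ` N \<union> (\<lambda>x. - int x) ` N)" using N(1) by (intro card_mono sub) auto
    also have "\<dots> \<le> card (int ` N) + card ((\<lambda>x. - int x) ` N)" by (rule card_Un_le)
    also have "\<dots> \<le> card N + card N" using N(1) by (intro add_mono card_image_le)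
    finally have "real (card Z) \<le> 2 * real (card N)" by simp
    also have "\<dots> \<le> 2 * (X powr e * (C * real k powr e))"
      using N(2) mult_left_mono[OF C(2)[OF k], of "X powr e"] by simp
    also have "\<dots> = 2 * C * (X * \<bar>real_of_int K\<bar>) powr e"
      using X by (simp add: powr_mult k_def)
    finally show "real (card Z) \<le> 2 * C * (X * \<bar>real_of_int K\<bar>) powr e" .
  qed (use C in auto)
qed

section \<open>Multiplicative relations between integers\<close>

text \<open>With \<open>d l\<close> the determinant of the matrix at position \<open>l\<close>, this
  is the condition that the product of the powers with exponents \<open>k l\<close> has determinant
  1.\<close>

definition mult_relation :: "nat \<Rightarrow> (nat \<Rightarrow> int) \<Rightarrow> (nat \<Rightarrow> int) \<Rightarrow> bool" where
  "mult_relation s d k \<longleftrightarrow> (\<Prod>l<s. (of_int (d l) :: rat) powi k l) = 1"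

lemma mult_relation_uminus: "mult_relation s d k \<Longrightarrow> mult_relation s d (\<lambda>l. - k l)"
  unfolding mult_relation_def by (simp add: power_int_minus prod_inversef[unfolded o_def])

text \<open>Used with \<open>N\<close> larger than all \<open>\<bar>k' l\<bar>\<close>: then no
  cancellation occurs on the support of \<open>k\<close>, and the new relation involves the supports
  of both.\<close>

lemma mult_relation_combine:
  assumes "mult_relation s d k" "mult_relation s d k'" "\<And>l. l < s \<Longrightarrow> d l \<noteq> 0"
  shows "mult_relation s d (\<lambda>l. k l * N + k' l)"
proof -
  have "(\<Prod>l<s. (of_int (d l) :: rat) powi (k l * N + k' l)) =
        (\<Prod>l<s. (of_int (d l) powi k l) powi N * of_int (d l) powi k' l)"
    using assms(3) by (intro prod.cong refl) (simp add: power_int_add power_int_mult)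
  also have "\<dots> = (\<Prod>l<s. of_int (d l) powi k l) powi N * (\<Prod>l<s. of_int (d l) powi k' l)"
  proof -
    have "(\<Prod>l\<in>A. (of_int (d l) powi k l) powi N) = ((\<Prod>l\<in>A. (of_int (d l) :: rat) powi k l) powi N)"
      if "finite A" for A
      using that by (induction A rule: finite_induct) (auto simp: power_int_mult_distrib)
    then show ?thesis by (simp add: prod.distrib)
  qed
  finally show ?thesis using assms(1,2) unfolding mult_relation_def by simp
qed

text \<open>Moving the negative exponents to the other side gives an equality of two integer
  products, and a prime dividing one of them divides the other.\<close>

lemma mult_relation_prime_transfer:
  assumes rel: "mult_relation s d k" and nz: "\<And>l. l < s \<Longrightarrow> d l \<noteq> 0"
    and l: "l < s" "k l > 0" and p: "prime p" "p dvd d l"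
  shows "\<exists>l'<s. k l' < 0 \<and> p dvd d l'"
proof -
  \<comment> \<open>Since \<open>nat\<close> truncates at 0, at most one of the two exponents is
    positive, and numerator and denominator separate the signs of \<open>k l\<close>.\<close>
  have pw: "(of_int (d l) :: rat) powi k l = of_int (d l ^ nat (k l)) / of_int (d l ^ nat (- k l))" if "l < s" for l
    using nz[OF that] by (cases "k l \<ge> 0") (auto simp: power_int_def field_simps)
  have "1 = (\<Prod>l<s. (of_int (d l ^ nat (k l)) :: rat) / of_int (d l ^ nat (- k l)))"
    using rel unfolding mult_relation_def by (simp add: pw)
  also have "\<dots> = of_int (\<Prod>l<s. d l ^ nat (k l)) / of_int (\<Prod>l<s. d l ^ nat (- k l))"
    by (simp add: prod_dividef)
  finally have "(of_int (\<Prod>l<s. d l ^ nat (k l)) :: rat) = of_int (\<Prod>l<s. d l ^ nat (- k l))"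
    using nz by (simp add: field_simps)
  then have eq: "(\<Prod>l<s. d l ^ nat (k l)) = (\<Prod>l<s. d l ^ nat (- k l))" by (simp only: of_int_eq_iff)
  have "d l dvd d l ^ nat (k l)" using l by (intro dvd_power) auto
  also have "\<dots> dvd (\<Prod>l<s. d l ^ nat (k l))" using l by (intro dvd_prodI) auto
  finally have "p dvd (\<Prod>l<s. d l ^ nat (- k l))" using p eq by (metis dvd_trans)
  then obtain l' where l': "l' < s" "p dvd d l' ^ nat (- k l')" using p(1) by (auto simp: prime_dvd_prod_iff)
  then have "k l' < 0" using p(1) by (cases "k l' < 0") auto
  moreover have "p dvd d l'" using l' p(1) prime_dvd_power by blast
  ultimately show ?thesis using l' by auto
qed

text \<open>\<open>T\<close> and \<open>T'\<close> are the sets called S and T in the opening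
  overview: \<open>T\<close> is the support of a relation with as many nonzero exponents as
  possible, \<open>T'\<close> the smaller of its positive and negative parts.\<close>

lemma mult_relation_core:
  assumes nz: "\<And>l. l < s \<Longrightarrow> d l \<noteq> 0"
  obtains T T' where "T \<subseteq> {..<s}" "T' \<subseteq> T" "2 * card T' \<le> card T"
    "\<And>l p. l \<in> T \<Longrightarrow> prime p \<Longrightarrow> p dvd d l \<Longrightarrow> p dvd (\<Prod>l\<in>T'. d l)"
    "\<And>k l. mult_relation s d k \<Longrightarrow> l < s \<Longrightarrow> k l \<noteq> 0 \<Longrightarrow> l \<in> T"
proof -
  define supp where "supp = (\<lambda>k::nat \<Rightarrow> int. {l. l < s \<and> k l \<noteq> 0})"
  have fin: "finite (supp k)" for k unfolding supp_def by simp
  have "\<exists>k. mult_relation s d k \<and> (\<forall>k'. mult_relation s d k' \<longrightarrow> card (supp k') \<le> card (supp k))"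
  proof (rule ex_has_greatest_nat)
    show "mult_relation s d (\<lambda>_. 0)" unfolding mult_relation_def by simp
    have "supp k \<subseteq> {..<s}" for k unfolding supp_def by auto
    then show "\<forall>k. mult_relation s d k \<longrightarrow> card (supp k) < Suc s"
      by (metis card_lessThan card_mono finite_lessThan less_Suc_eq_le)
  qed
  then obtain k where k: "mult_relation s d k"
    and kmax: "\<And>k'. mult_relation s d k' \<Longrightarrow> card (supp k') \<le> card (supp k)" by blast
  have supp: "l \<in> supp k" if k': "mult_relation s d k'" and l: "l < s" "k' l \<noteq> 0" for k' l
  proof (rule ccontr)
    assume nl: "l \<notin> supp k"
    \<comment> \<open>With this \<open>N\<close>, the exponent \<open>k i * N + k' i\<close> is
      nonzero wherever \<open>k i\<close> is, and equals \<open>k' l\<close> at the new index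
      \<open>l\<close>. The support would grow, against maximality.\<close>
    define N where "N = 1 + (\<Sum>l<s. \<bar>k' l\<bar>)"
    have big: "N > \<bar>k' i\<bar>" if "i < s" for i
    proof -
      have "\<bar>k' i\<bar> \<le> (\<Sum>l<s. \<bar>k' l\<bar>)" using that by (intro member_le_sum) auto
      then show ?thesis unfolding N_def by simp
    qed
    have rel: "mult_relation s d (\<lambda>l. k l * N + k' l)" by (rule mult_relation_combine[OF k k' nz])
    have "insert l (supp k) \<subseteq> supp (\<lambda>l. k l * N + k' l)"
    proof
      fix i assume i: "i \<in> insert l (supp k)"
      show "i \<in> supp (\<lambda>l. k l * N + k' l)"
      proof (cases "i = l")
        case True then show ?thesis using l nl unfolding supp_def by auto
      next
        case False
        then have i: "i < s" "k i \<noteq> 0" using i unfolding supp_def by auto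
        have "\<bar>k i * N\<bar> \<ge> 1 * N"
          using i(2) big[OF i(1)] unfolding abs_mult by (intro mult_mono) auto
        then have "k i * N + k' i \<noteq> 0" using big[OF i(1)] by linarith
        then show ?thesis using i unfolding supp_def by auto
      qed
    qed
    then have "card (insert l (supp k)) \<le> card (supp (\<lambda>l. k l * N + k' l))" by (intro card_mono fin)
    then show False using kmax[OF rel] nl fin[of k] by simp
  qed
  \<comment> \<open>Every prime occurring on one side of the relation occurs on the other, so either
    side alone carries all primes of the support; the smaller side has at most half of it.\<close>
  define I where "I = {l. l < s \<and> k l > 0}"
  define J where "J = {l. l < s \<and> k l < 0}"
  have IJ: "supp k = I \<union> J" "I \<inter> J = {}" "finite I" "finite J" unfolding supp_def I_def J_def by auto
  have tr1: "p dvd (\<Prod>l\<in>J. d l)" if "l \<in> I" "prime p" "p dvd d l" for l p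
    using mult_relation_prime_transfer[OF k nz, of l p] that IJ unfolding I_def J_def
    by (auto simp: prime_dvd_prod_iff)
  have tr2: "p dvd (\<Prod>l\<in>I. d l)" if "l \<in> J" "prime p" "p dvd d l" for l p
    using mult_relation_prime_transfer[OF mult_relation_uminus[OF k] nz, of l p] that IJ unfolding I_def J_def
    by (auto simp: prime_dvd_prod_iff)
  have tr0: "p dvd (\<Prod>l\<in>A. d l)" if "l \<in> A" "finite A" "p dvd d l" for l p A
    using that by (meson dvd_prodI dvd_trans)
  have card: "card (supp k) = card I + card J" using IJ by (simp add: card_Un_disjoint)
  have "supp k \<subseteq> {..<s}" unfolding supp_def by auto
  show ?thesis
  proof (cases "card I \<le> card J")
    case True
    show ?thesis
    proof (rule that)
      show "supp k \<subseteq> {..<s}" "I \<subseteq> supp k" "2 * card I \<le> card (supp k)"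
        using IJ True card \<open>supp k \<subseteq> {..<s}\<close> by auto
      show "p dvd (\<Prod>l\<in>I. d l)" if "l \<in> supp k" "prime p" "p dvd d l" for l p
      proof (cases "l \<in> I")
        case True
        then show ?thesis using tr0 IJ that by blast
      next
        case False
        then show ?thesis using tr2[of l p] IJ that by blast
      qed
      show "l \<in> supp k" if "mult_relation s d k'" "l < s" "k' l \<noteq> 0" for k' l
        using supp[OF that] .
    qed
  next
    case False
    show ?thesis
    proof (rule that)
      show "supp k \<subseteq> {..<s}" "J \<subseteq> supp k" "2 * card J \<le> card (supp k)"
        using IJ False card \<open>supp k \<subseteq> {..<s}\<close> by auto
      show "p dvd (\<Prod>l\<in>J. d l)" if "l \<in> supp k" "prime p" "p dvd d l" for l p
      proof (cases "l \<in> J")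
        case True
        then show ?thesis using tr0 IJ that by blast
      next
        case False
        then show ?thesis using tr1[of l p] IJ that by blast
      qed
      show "l \<in> supp k" if "mult_relation s d k'" "l < s" "k' l \<noteq> 0" for k' l
        using supp[OF that] .
    qed
  qed
qed

section \<open>Matrices with few determinants\<close>

definition int_box :: "nat \<Rightarrow> real \<Rightarrow> int vec set" where
  "int_box n H = {v \<in> carrier_vec n. \<forall>i<n. \<bar>real_of_int (v $ i)\<bar> \<le> H}"

text \<open>The exact count is twice the floor of \<open>H\<close>, plus 1. The lower bound serves
  the translation argument on hyperplanes; the upper bound is the source of the base
  \<open>3 * H\<close> in all later box counts.\<close>

lemma card_int_interval:
  assumes "H \<ge> 0"
  shows "finite {c::int. \<bar>real_of_int c\<bar> \<le> H}" "real (card {c::int. \<bar>real_of_int c\<bar> \<le> H}) \<ge> H"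
    "H \<ge> 1 \<Longrightarrow> real (card {c::int. \<bar>real_of_int c\<bar> \<le> H}) \<le> 3 * H"
proof -
  have eq: "{c::int. \<bar>real_of_int c\<bar> \<le> H} = {- \<lfloor>H\<rfloor>..\<lfloor>H\<rfloor>}"
    by (auto simp: abs_le_iff le_floor_iff) linarith+
  have "real (card {c::int. \<bar>real_of_int c\<bar> \<le> H}) = 2 * real_of_int \<lfloor>H\<rfloor> + 1"
    unfolding eq using assms by simp
  moreover have "0 \<le> real_of_int \<lfloor>H\<rfloor>" "real_of_int \<lfloor>H\<rfloor> \<le> H" "H < real_of_int \<lfloor>H\<rfloor> + 1"
    using assms by simp_all
  ultimately show "real (card {c::int. \<bar>real_of_int c\<bar> \<le> H}) \<ge> H"
    "H \<ge> 1 \<Longrightarrow> real (card {c::int. \<bar>real_of_int c\<bar> \<le> H}) \<le> 3 * H" by linarith+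
  show "finite {c::int. \<bar>real_of_int c\<bar> \<le> H}" unfolding eq by simp
qed

lemma card_int_box:
  assumes "H \<ge> 1"
  shows "finite (int_box n H)" "real (card (int_box n H)) \<le> (3 * H) ^ n"
proof -
  define I where "I = {c::int. \<bar>real_of_int c\<bar> \<le> H}"
  have I: "finite I" "real (card I) \<le> 3 * H" using card_int_interval[of H] assms unfolding I_def by auto
  have sub: "int_box n H \<subseteq> vec n ` ({..<n} \<rightarrow>\<^sub>E I)"
  proof
    fix v assume v: "v \<in> int_box n H"
    have "v = vec n (restrict (\<lambda>i. v $ i) {..<n})" using v unfolding int_box_def by (intro eq_vecI) auto
    moreover have "restrict (\<lambda>i. v $ i) {..<n} \<in> {..<n} \<rightarrow>\<^sub>E I" using v unfolding int_box_def I_def by auto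
    ultimately show "v \<in> vec n ` ({..<n} \<rightarrow>\<^sub>E I)" by blast
  qed
  have fin: "finite ({..<n} \<rightarrow>\<^sub>E I)" using I by (intro finite_PiE) auto
  show "finite (int_box n H)" using sub fin by (meson finite_imageI finite_subset)
  have "card (int_box n H) \<le> card ({..<n} \<rightarrow>\<^sub>E I)"
    using card_mono[OF finite_imageI[OF fin] sub] card_image_le[OF fin, of "vec n"] by linarith
  also have "\<dots> = card I ^ n" by (simp add: card_PiE)
  finally have "real (card (int_box n H)) \<le> real (card I) ^ n" by (metis of_nat_le_iff of_nat_power)
  also have "\<dots> \<le> (3 * H) ^ n" using I by (intro power_mono) auto
  finally show "real (card (int_box n H)) \<le> (3 * H) ^ n" .
qed

lemma card_le_fibres:
  fixes M :: real
  assumes "finite A" "finite B" "f ` A \<subseteq> B" "M \<ge> 0"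
    and "\<And>a. a \<in> A \<Longrightarrow> real (card {a' \<in> A. f a' = f a}) \<le> M"
  shows "real (card A) \<le> real (card B) * M"
proof -
  have "card A = (\<Sum>b\<in>f ` A. card {a' \<in> A. f a' = b})"
    using sum.image_gen[OF assms(1), of "\<lambda>_. 1::nat" f] by (simp add: conj_commute)
  then have "real (card A) = (\<Sum>b\<in>f ` A. real (card {a' \<in> A. f a' = b}))" by simp
  also have "\<dots> \<le> (\<Sum>b\<in>f ` A. M)" using assms(5) by (intro sum_mono) auto
  also have "\<dots> \<le> real (card B) * M"
    using assms card_mono[OF assms(2,3)] by (simp add: mult_right_mono)
  finally show ?thesis .
qed

text \<open>Such matrices share the cofactors of row \<open>q\<close>. Counting fixes the other rows
  first and then asks how many rows \<open>q\<close> remain.\<close>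

definition agree_off :: "nat \<Rightarrow> nat \<Rightarrow> int mat \<Rightarrow> int mat \<Rightarrow> bool" where
  "agree_off n q A A' \<longleftrightarrow> (\<forall>i<n. i \<noteq> q \<longrightarrow> row A i = row A' i)"

lemma card_mats_by_rows:
  fixes M :: real
  assumes "finite \<A>" "\<A> \<subseteq> carrier_mat n n" "q < n" "M \<ge> 0" "finite R"
    and rows: "\<And>A i. A \<in> \<A> \<Longrightarrow> i < n \<Longrightarrow> i \<noteq> q \<Longrightarrow> row A i \<in> R"
    and fibre: "\<And>A. A \<in> \<A> \<Longrightarrow> real (card ((\<lambda>A'. row A' q) ` {A' \<in> \<A>. agree_off n q A A'})) \<le> M"
  shows "real (card \<A>) \<le> real (card R) ^ (n - 1) * M"
proof -
  define f where "f = (\<lambda>A::int mat. restrict (\<lambda>i. row A i) ({..<n} - {q}))"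
  have f: "f A' = f A \<longleftrightarrow> agree_off n q A A'" for A A'
    unfolding f_def agree_off_def restrict_def by (auto simp: fun_eq_iff)
  have "real (card \<A>) \<le> real (card (({..<n} - {q}) \<rightarrow>\<^sub>E R)) * M"
  proof (rule card_le_fibres[where f = f])
    show "f ` \<A> \<subseteq> ({..<n} - {q}) \<rightarrow>\<^sub>E R" using rows unfolding f_def by (auto simp: PiE_iff restrict_def split: if_splits)
    fix A assume A: "A \<in> \<A>"
    have "inj_on (\<lambda>A'. row A' q) {A' \<in> \<A>. agree_off n q A A'}"
    proof (rule inj_onI)
      fix A1 A2 assume 1: "A1 \<in> {A' \<in> \<A>. agree_off n q A A'}" and 2: "A2 \<in> {A' \<in> \<A>. agree_off n q A A'}"
        and q: "row A1 q = row A2 q"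
      have "A1 \<in> carrier_mat n n" "A2 \<in> carrier_mat n n" using 1 2 assms(2) by auto
      moreover have "row A1 i = row A2 i" if "i < n" for i
        using 1 2 q that unfolding agree_off_def by (cases "i = q") auto
      ultimately show "A1 = A2" by (intro eq_rowI) auto
    qed
    then show "real (card {a' \<in> \<A>. f a' = f A}) \<le> M"
      using fibre[OF A] unfolding f by (simp add: card_image)
  qed (use assms in \<open>auto intro: finite_PiE\<close>)
  also have "card (({..<n} - {q}) \<rightarrow>\<^sub>E R) = card R ^ (n - 1)"
    using assms(3) by (simp add: card_PiE)
  finally show ?thesis by simp
qed

lemma int_mats_iff_rows:
  "A \<in> int_mats n H \<longleftrightarrow> A \<in> carrier_mat n n \<and> (\<forall>i<n. row A i \<in> int_box n H)"
  unfolding int_mats_def int_box_def by auto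

lemma card_int_mats:
  assumes "H \<ge> 1"
  shows "finite (int_mats n H)" "real (card (int_mats n H)) \<le> (3 * H) ^ (n ^ 2)"
proof -
  have inj: "inj_on (\<lambda>A. restrict (\<lambda>i. row A i) {..<n}) (int_mats n H)"
  proof (rule inj_onI)
    fix A B assume A: "A \<in> int_mats n H" and B: "B \<in> int_mats n H"
      and eq: "restrict (\<lambda>i. row A i) {..<n} = restrict (\<lambda>i. row B i) {..<n}"
    have "row A i = row B i" if "i < n" for i
      using fun_cong[OF eq, of i] that by simp
    then show "A = B" using A B unfolding int_mats_def by (intro eq_rowI) auto
  qed
  have sub: "(\<lambda>A. restrict (\<lambda>i. row A i) {..<n}) ` int_mats n H \<subseteq> {..<n} \<rightarrow>\<^sub>E int_box n H"
    by (auto simp: int_mats_iff_rows)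
  have fin: "finite ({..<n} \<rightarrow>\<^sub>E int_box n H)" using card_int_box(1)[OF assms] by (intro finite_PiE) auto
  show "finite (int_mats n H)" using inj sub fin by (meson finite_imageD finite_subset)
  have "card (int_mats n H) \<le> card ({..<n} \<rightarrow>\<^sub>E int_box n H)"
    using card_inj_on_le[OF inj sub fin] .
  also have "\<dots> = card (int_box n H) ^ n" by (simp add: card_PiE)
  finally have "real (card (int_mats n H)) \<le> real (card (int_box n H)) ^ n" by (metis of_nat_le_iff of_nat_power)
  also have "\<dots> \<le> ((3 * H) ^ n) ^ n" using card_int_box(2)[OF assms] by (intro power_mono) auto
  finally show "real (card (int_mats n H)) \<le> (3 * H) ^ (n ^ 2)" by (simp add: power_mult power2_eq_square)
qed

section \<open>Size of determinants and cofactors\<close>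

lemma abs_det_le:
  fixes A :: "int mat"
  assumes "A \<in> carrier_mat n n" "\<And>i j. i < n \<Longrightarrow> j < n \<Longrightarrow> \<bar>real_of_int (A $$ (i, j))\<bar> \<le> H"
  shows "\<bar>real_of_int (det A)\<bar> \<le> fact n * H ^ n"
proof -
  have "\<bar>real_of_int (det A)\<bar> =
    \<bar>\<Sum>p | p permutes {0..<n}. real_of_int (signof p) * (\<Prod>i = 0..<n. real_of_int (A $$ (i, p i)))\<bar>"
    unfolding det_def'[OF assms(1)] by simp
  also have "\<dots> \<le> (\<Sum>p | p permutes {0..<n}. \<bar>real_of_int (signof p) * (\<Prod>i = 0..<n. real_of_int (A $$ (i, p i)))\<bar>)"
    by (rule sum_abs)
  also have "\<dots> \<le> (\<Sum>p | p permutes {0..<n}. H ^ n)"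
  proof (intro sum_mono)
    fix p assume "p \<in> {p. p permutes {0..<n}}"
    then have p: "p i < n" if "i < n" for i using permutes_in_image[of p "{0..<n}" i] that by auto
    have "\<bar>real_of_int (signof p) * (\<Prod>i = 0..<n. real_of_int (A $$ (i, p i)))\<bar>
       = (\<Prod>i = 0..<n. \<bar>real_of_int (A $$ (i, p i))\<bar>)"
      by (simp add: abs_mult abs_prod sign_def)
    also have "\<dots> \<le> (\<Prod>i = 0..<n. H)" using assms(2) p by (intro prod_mono) auto
    finally show "\<bar>real_of_int (signof p) * (\<Prod>i = 0..<n. real_of_int (A $$ (i, p i)))\<bar> \<le> H ^ n" by simp
  qed
  also have "\<dots> = fact n * H ^ n" by (simp add: card_permutations[of "{0..<n}" n])
  finally show ?thesis .
qed

lemma abs_cofactor_le: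
  fixes A :: "int mat"
  assumes "A \<in> int_mats n H" "i < n" "j < n" "H \<ge> 1"
  shows "\<bar>real_of_int (cofactor A i j)\<bar> \<le> fact n * H ^ n"
proof -
  have A: "A \<in> carrier_mat n n" "\<And>i j. i < n \<Longrightarrow> j < n \<Longrightarrow> \<bar>real_of_int (A $$ (i, j))\<bar> \<le> H"
    using assms(1) unfolding int_mats_def by auto
  have "\<bar>real_of_int (det (mat_delete A i j))\<bar> \<le> fact (n - 1) * H ^ (n - 1)"
  proof (rule abs_det_le)
    show "mat_delete A i j \<in> carrier_mat (n - 1) (n - 1)" using A(1) unfolding mat_delete_def by auto
    fix a b assume "a < n - 1" "b < n - 1"
    then show "\<bar>real_of_int (mat_delete A i j $$ (a, b))\<bar> \<le> H"
      using A unfolding mat_delete_def by auto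
  qed
  also have "\<dots> \<le> fact n * H ^ n"
    using assms(4) by (intro mult_mono fact_mono power_increasing) auto
  finally show ?thesis unfolding cofactor_def by (simp add: abs_mult power_abs)
qed

lemma cofactor_cong_agree_off:
  assumes "A \<in> carrier_mat n n" "A' \<in> carrier_mat n n" "agree_off n q A A'" "q < n" "j < n"
  shows "cofactor A q j = cofactor A' q j"
proof -
  have ent: "A $$ (i, k) = A' $$ (i, k)" if "i < n" "i \<noteq> q" "k < n" for i k
    using assms that unfolding agree_off_def by (metis carrier_matD index_row(1))
  have "mat_delete A q j = mat_delete A' q j"
    using assms by (intro eq_matI) (auto simp: mat_delete_def intro!: ent)
  then show ?thesis unfolding cofactor_def by simp
qed

text \<open>The reduction modulo the lattice spanned by the rows \<open>i \<noteq> q\<close> keeps the representative of the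
  coset in a box; \<open>unit_vec n m\<close> supplies the missing direction.\<close>
lemma small_point_on_hyperplane:
  fixes A :: "int mat"
  assumes A: "A \<in> carrier_mat n n" "det A \<noteq> 0" and q: "q < n" "m < n" "row A q = unit_vec n m"
    and rows: "\<And>i. i < n \<Longrightarrow> i \<noteq> q \<Longrightarrow> row A i \<in> int_box n H \<and> row A i \<bullet> w = 0"
    and w: "w \<in> carrier_vec n" "w $ m \<noteq> 0"
    and y0: "y0 \<in> carrier_vec n" "y0 \<bullet> w = 1" and H: "H \<ge> 0"
    and c: "\<bar>real_of_int c\<bar> \<le> \<bar>real_of_int (w $ m)\<bar> * H"
  shows "\<exists>y\<in>int_box n (real n * H). y \<bullet> w = c"
proof -
  define d where "d = det A"
  \<comment> \<open>Cramer's rule: \<open>u i / d\<close> are the coordinates of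
    \<open>c * y0\<close> with respect to the rows of \<open>A\<close>.\<close>
  define u where "u = (\<lambda>i. \<Sum>k<n. c * y0 $ k * adj_mat A $$ (k, i))"
  \<comment> \<open>Subtract the integer part of each coordinate except the one along row
    \<open>q\<close>. The subtracted rows are orthogonal to \<open>w\<close>, so the value at
    \<open>w\<close> stays \<open>c\<close>.\<close>
  define y where "y = vec n (\<lambda>j. c * y0 $ j - (\<Sum>i\<in>{..<n} - {q}. (u i div d) * A $$ (i, j)))"
  have Aq: "A $$ (q, j) = (if j = m then 1 else 0)" if "j < n" for j
  proof -
    have "A $$ (q, j) = row A q $ j" using A(1) q(1) that by simp
    then show ?thesis using that q by simp
  qed
  have Aw: "(\<Sum>j<n. A $$ (i, j) * w $ j) = 0" if "i < n" "i \<noteq> q" for i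
  proof -
    have "row A i \<bullet> w = (\<Sum>j<n. A $$ (i, j) * w $ j)"
      using A(1) w that by (auto simp: scalar_prod_def atLeast0LessThan)
    then show ?thesis using rows[OF that] by simp
  qed
  have Awq: "(\<Sum>j<n. A $$ (q, j) * w $ j) = w $ m"
  proof -
    have "(\<Sum>j<n. A $$ (q, j) * w $ j) = (\<Sum>j<n. if j = m then w $ j else 0)"
      by (intro sum.cong) (auto simp: Aq)
    then show ?thesis using q by simp
  qed
  have dy: "d * (c * y0 $ j) = (\<Sum>i<n. u i * A $$ (i, j))" if j: "j < n" for j
  proof -
    have adj: "(\<Sum>i<n. adj_mat A $$ (k, i) * A $$ (i, j)) = (if k = j then d else 0)" if "k < n" for k
    proof -
      have "(\<Sum>i<n. adj_mat A $$ (k, i) * A $$ (i, j)) = (adj_mat A * A) $$ (k, j)"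
        using A(1) adj_mat(1)[OF A(1)] that j by (auto simp: scalar_prod_def atLeast0LessThan)
      also have "\<dots> = (if k = j then d else 0)" unfolding adj_mat(3)[OF A(1)] d_def using that j by simp
      finally show ?thesis .
    qed
    have "(\<Sum>i<n. u i * A $$ (i, j)) = (\<Sum>i<n. \<Sum>k<n. c * y0 $ k * (adj_mat A $$ (k, i) * A $$ (i, j)))"
      unfolding u_def by (simp add: sum_distrib_right sum_distrib_left mult_ac)
    also have "\<dots> = (\<Sum>k<n. c * y0 $ k * (\<Sum>i<n. adj_mat A $$ (k, i) * A $$ (i, j)))"
      by (subst sum.swap) (simp add: sum_distrib_left)
    also have "\<dots> = (\<Sum>k<n. if k = j then c * y0 $ k * d else 0)" by (intro sum.cong) (auto simp: adj)
    finally show ?thesis using j by simp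
  qed
  have y0w: "(\<Sum>j<n. y0 $ j * w $ j) = 1"
    using y0 w by (auto simp: scalar_prod_def atLeast0LessThan)
  have swap: "(\<Sum>j<n. (\<Sum>i\<in>S. f i * A $$ (i, j)) * w $ j) = (\<Sum>i\<in>S. f i * (\<Sum>j<n. A $$ (i, j) * w $ j))"
    for S and f :: "nat \<Rightarrow> int"
    by (simp add: sum_distrib_right sum_distrib_left mult_ac) (rule sum.swap)
  have split: "(\<Sum>i<n. f i) = f q + (\<Sum>i\<in>{..<n} - {q}. f i)" for f :: "nat \<Rightarrow> int"
    using q(1) by (simp add: sum.remove)
  \<comment> \<open>Pairing \<open>d * c * y0\<close> with \<open>w\<close> kills all rows except
    row \<open>q\<close>, which contributes \<open>w $ m\<close>. This determines the coordinate
    along the unit vector, and the bound on \<open>c\<close> makes it at most \<open>H\<close> in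
    absolute value.\<close>
  have "d * c = (\<Sum>j<n. d * (c * y0 $ j) * w $ j)"
    using y0w by (simp add: mult_ac flip: sum_distrib_left)
  also have "\<dots> = (\<Sum>j<n. (\<Sum>i<n. u i * A $$ (i, j)) * w $ j)" by (intro sum.cong) (auto simp: dy)
  also have "\<dots> = u q * w $ m"
    unfolding swap by (subst split) (simp add: Aw Awq)
  finally have uq: "d * c = u q * w $ m" .
  have d0: "d \<noteq> 0" using A(2) unfolding d_def .
  have uqH: "\<bar>real_of_int (u q)\<bar> \<le> \<bar>real_of_int d\<bar> * H"
  proof -
    have "\<bar>real_of_int (u q)\<bar> * \<bar>real_of_int (w $ m)\<bar> = \<bar>real_of_int d\<bar> * \<bar>real_of_int c\<bar>"
      using arg_cong[OF uq, of "\<lambda>x. \<bar>real_of_int x\<bar>"] by (simp add: abs_mult)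
    also have "\<dots> \<le> \<bar>real_of_int d\<bar> * (\<bar>real_of_int (w $ m)\<bar> * H)" using c by (intro mult_left_mono) auto
    finally show ?thesis using w(2) by (simp add: mult_ac)
  qed
  have "\<bar>real_of_int (y $ j)\<bar> \<le> real n * H" if j: "j < n" for j
  proof -
    \<comment> \<open>After multiplication by \<open>d\<close>, the reduced coordinates are the
      remainders \<open>u i mod d\<close>, smaller than \<open>\<bar>d\<bar>\<close>.\<close>
    have "d * y $ j = (\<Sum>i<n. u i * A $$ (i, j)) - (\<Sum>i\<in>{..<n} - {q}. (d * (u i div d)) * A $$ (i, j))"
      unfolding y_def using j dy[OF j] by (simp add: right_diff_distrib sum_distrib_left mult_ac)
    also have "\<dots> = u q * A $$ (q, j) + (\<Sum>i\<in>{..<n} - {q}. (u i - d * (u i div d)) * A $$ (i, j))"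
      by (subst split) (simp add: left_diff_distrib sum_subtractf)
    also have "\<dots> = u q * A $$ (q, j) + (\<Sum>i\<in>{..<n} - {q}. (u i mod d) * A $$ (i, j))"
      by (simp add: minus_mult_div_eq_mod)
    finally have eq: "d * y $ j = u q * A $$ (q, j) + (\<Sum>i\<in>{..<n} - {q}. (u i mod d) * A $$ (i, j))" .
    have "\<bar>real_of_int d\<bar> * \<bar>real_of_int (y $ j)\<bar> = \<bar>real_of_int (d * y $ j)\<bar>" by (simp add: abs_mult)
    also have "\<dots> = \<bar>real_of_int (u q * A $$ (q, j)) + (\<Sum>i\<in>{..<n} - {q}. real_of_int ((u i mod d) * A $$ (i, j)))\<bar>"
      unfolding eq by simp
    also have "\<dots> \<le> \<bar>real_of_int (u q * A $$ (q, j))\<bar> + \<bar>\<Sum>i\<in>{..<n} - {q}. real_of_int ((u i mod d) * A $$ (i, j))\<bar>"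
      by (rule abs_triangle_ineq)
    also have "\<dots> \<le> \<bar>real_of_int (u q * A $$ (q, j))\<bar> + (\<Sum>i\<in>{..<n} - {q}. \<bar>real_of_int ((u i mod d) * A $$ (i, j))\<bar>)"
      by (intro add_left_mono sum_abs)
    also have "\<dots> \<le> \<bar>real_of_int d\<bar> * H + (\<Sum>i\<in>{..<n} - {q}. \<bar>real_of_int d\<bar> * H)"
    proof (intro add_mono sum_mono)
      show "\<bar>real_of_int (u q * A $$ (q, j))\<bar> \<le> \<bar>real_of_int d\<bar> * H"
        using uqH H by (simp add: Aq[OF j])
      fix i assume i: "i \<in> {..<n} - {q}"
      have "\<bar>u i mod d\<bar> \<le> \<bar>d\<bar>" using abs_mod_less[OF d0, of "u i"] by linarith
      then have "\<bar>real_of_int (u i mod d)\<bar> \<le> \<bar>real_of_int d\<bar>" by linarith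
      moreover have "\<bar>real_of_int (A $$ (i, j))\<bar> \<le> H"
        using rows[of i] i j A(1) unfolding int_box_def by auto
      ultimately show "\<bar>real_of_int ((u i mod d) * A $$ (i, j))\<bar> \<le> \<bar>real_of_int d\<bar> * H"
        by (simp add: abs_mult mult_mono)
    qed
    \<comment> \<open>One share \<open>\<bar>d\<bar> * H\<close> comes from row \<open>q\<close> and
      \<open>n - 1\<close> shares from the other rows.\<close>
    also have "\<dots> = \<bar>real_of_int d\<bar> * (real n * H)" using q(1) by (simp add: of_nat_diff algebra_simps)
    finally show ?thesis using d0 by simp
  qed
  then have "y \<in> int_box n (real n * H)" unfolding int_box_def y_def by auto
  moreover have "y \<bullet> w = c"
  proof -
    have "y \<bullet> w = (\<Sum>j<n. (c * y0 $ j - (\<Sum>i\<in>{..<n} - {q}. (u i div d) * A $$ (i, j))) * w $ j)"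
      using w(1) unfolding y_def by (simp add: scalar_prod_def atLeast0LessThan)
    also have "\<dots> = c * (\<Sum>j<n. y0 $ j * w $ j) - (\<Sum>j<n. (\<Sum>i\<in>{..<n} - {q}. (u i div d) * A $$ (i, j)) * w $ j)"
      by (simp only: left_diff_distrib sum_subtractf sum_distrib_left mult.assoc)
    also have "\<dots> = c" unfolding swap using y0w by (simp add: Aw)
    finally show ?thesis .
  qed
  ultimately show ?thesis by blast
qed

text \<open>Translating the solutions by representatives of the values \<open>\<bar>c'\<bar> \<le> \<bar>w $ m\<bar> * H\<close> gives
  disjoint subsets of a box of comparable size.\<close>
lemma card_hyperplane_box_le:
  fixes A :: "int mat"
  assumes A: "A \<in> carrier_mat n n" "det A \<noteq> 0" and q: "q < n" "m < n" "row A q = unit_vec n m"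
    and rows: "\<And>i. i < n \<Longrightarrow> i \<noteq> q \<Longrightarrow> row A i \<in> int_box n H \<and> row A i \<bullet> w = 0"
    and w: "w \<in> carrier_vec n" "w $ m \<noteq> 0"
    and y0: "y0 \<in> carrier_vec n" "y0 \<bullet> w = 1" and H: "H \<ge> 1"
  shows "real (card {x \<in> int_box n H. x \<bullet> w = c}) * (\<bar>real_of_int (w $ m)\<bar> * H) \<le> (3 * real (n + 2) * H) ^ n"
proof (cases "{x \<in> int_box n H. x \<bullet> w = c} = {}")
  case True
  show ?thesis unfolding True using H by simp
next
  case False
  define S where "S = {x \<in> int_box n H. x \<bullet> w = c}"
  define K where "K = {c::int. \<bar>real_of_int c\<bar> \<le> \<bar>real_of_int (w $ m)\<bar> * H}"
  have K: "finite K" "real (card K) \<ge> \<bar>real_of_int (w $ m)\<bar> * H"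
    using card_int_interval[of "\<bar>real_of_int (w $ m)\<bar> * H"] H unfolding K_def by auto
  have S: "finite S" unfolding S_def using card_int_box[OF H] by auto
  obtain x0 where x0: "x0 \<in> S" using False unfolding S_def by auto
  have "\<forall>c\<in>K. \<exists>y\<in>int_box n (real n * H). y \<bullet> w = c"
    using small_point_on_hyperplane[OF A q rows w y0] H unfolding K_def by auto
  then obtain y where y: "\<And>c. c \<in> K \<Longrightarrow> y c \<in> int_box n (real n * H) \<and> y c \<bullet> w = c" by metis
  \<comment> \<open>Subtracting the fixed solution \<open>x0\<close> gives \<open>g (x, k)\<close>
    the value \<open>k\<close> at \<open>w\<close>. So \<open>k\<close> can be read off from the
    image, and then \<open>x\<close>.\<close>
  define g where "g = (\<lambda>(x, c). x - x0 + y c)"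
  have cv: "x \<in> carrier_vec n" if "x \<in> S" for x using that unfolding S_def int_box_def by auto
  have cy: "y c \<in> carrier_vec n" if "c \<in> K" for c using y[OF that] unfolding int_box_def by auto
  have val: "g (x, k) \<bullet> w = k" if "x \<in> S" "k \<in> K" for x k
  proof -
    have "g (x, k) \<bullet> w = x \<bullet> w - x0 \<bullet> w + y k \<bullet> w"
      unfolding g_def using cv[OF that(1)] cv[OF x0] cy[OF that(2)] w(1)
      by (simp add: add_scalar_prod_distrib[of _ n] minus_scalar_prod_distrib[of _ n])
    then show ?thesis using that x0 y unfolding S_def by auto
  qed
  have "inj_on g (S \<times> K)"
  proof (rule inj_onI, clarify)
    fix x k x' k' assume x: "x \<in> S" "k \<in> K" "x' \<in> S" "k' \<in> K" and eq: "g (x, k) = g (x', k')"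
    have "k = k'" using val x eq by metis
    moreover have "x = x'"
    proof (rule eq_vecI)
      show "dim_vec x = dim_vec x'" using cv x by (metis carrier_vecD)
      fix i assume i: "i < dim_vec x'"
      have d: "x \<in> carrier_vec n" "x' \<in> carrier_vec n" "x0 \<in> carrier_vec n" "y k \<in> carrier_vec n"
        using cv x x0 cy by auto
      have "g (x, k) $ i = g (x', k') $ i" using eq by simp
      then show "x $ i = x' $ i" using d i \<open>k = k'\<close> unfolding g_def by auto
    qed
    ultimately show "x = x' \<and> k = k'" by simp
  qed
  \<comment> \<open>\<open>x\<close> and \<open>x0\<close> contribute \<open>H\<close> each and
    \<open>y k\<close> contributes \<open>n * H\<close>.\<close>
  moreover have "g ` (S \<times> K) \<subseteq> int_box n (real (n + 2) * H)"
  proof clarify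
    fix x k assume x: "x \<in> S" "k \<in> K"
    have d: "x \<in> carrier_vec n" "x0 \<in> carrier_vec n" "y k \<in> carrier_vec n" using cv x x0 cy by auto
    have "\<bar>real_of_int (g (x, k) $ i)\<bar> \<le> real (n + 2) * H" if i: "i < n" for i
    proof -
      have "\<bar>real_of_int (x $ i)\<bar> \<le> H" "\<bar>real_of_int (x0 $ i)\<bar> \<le> H" "\<bar>real_of_int (y k $ i)\<bar> \<le> real n * H"
        using x x0 y i unfolding S_def int_box_def by auto
      moreover have "g (x, k) $ i = x $ i - x0 $ i + y k $ i" using d i unfolding g_def by simp
      ultimately show ?thesis by (simp add: algebra_simps)
    qed
    then show "g (x, k) \<in> int_box n (real (n + 2) * H)" using d unfolding int_box_def g_def by auto
  qed
  moreover have H': "real (n + 2) * H \<ge> 1"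
    using H mult_mono[of 1 "real (n + 2)" 1 H] by simp
  ultimately have "card (S \<times> K) \<le> card (int_box n (real (n + 2) * H))"
    by (intro card_inj_on_le[of g] card_int_box(1))
  then have "real (card S * card K) \<le> (3 * (real (n + 2) * H)) ^ n"
    using card_int_box(2)[OF H', of n] by (simp add: card_cartesian_product del: of_nat_mult)
  moreover have "real (card S) * (\<bar>real_of_int (w $ m)\<bar> * H) \<le> real (card S) * real (card K)"
    using K(2) by (intro mult_left_mono) auto
  ultimately show ?thesis unfolding S_def by (simp add: mult_ac)
qed

section \<open>Primitive normal vectors\<close>

text \<open>Bezout for finitely many integers, by iterating the case of two. \<open>g\<close> is a
  greatest common divisor, and it is 0 only if all \<open>v i\<close> are.\<close>

lemma bezout_sum:
  fixes v :: "nat \<Rightarrow> int"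
  shows "\<exists>g y. (\<forall>i<n. g dvd v i) \<and> (\<Sum>i<n. v i * y i) = g"
proof (induction n)
  case (Suc n)
  then obtain g y where g: "\<forall>i<n. g dvd v i" "(\<Sum>i<n. v i * y i) = g" by blast
  obtain a b where ab: "a * g + b * v n = gcd g (v n)" using bezout_int by blast
  have "(\<Sum>i<n. v i * (a * y i)) = a * (\<Sum>i<n. v i * y i)" by (simp add: sum_distrib_left mult_ac)
  then have "(\<Sum>i<Suc n. v i * (if i < n then a * y i else b)) = gcd g (v n)"
    using ab g(2) by (simp add: mult_ac)
  moreover have "\<forall>i<Suc n. gcd g (v n) dvd v i"
    using g(1) by (auto simp: less_Suc_eq intro: dvd_trans)
  ultimately show ?case
    by (intro exI[of _ "gcd g (v n)"] exI[of _ "\<lambda>i. if i < n then a * y i else b"] conjI)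
qed simp

text \<open>Divide by the greatest common divisor of the entries. Primitivity is recorded by a
  vector \<open>y\<close> with \<open>y \<bullet> w = 1\<close>, which later supplies points on
  every hyperplane parallel to the one orthogonal to \<open>w\<close>.\<close>

lemma primitive_multiple:
  fixes v :: "int vec"
  assumes v: "v \<in> carrier_vec n" "i < n" "v $ i \<noteq> 0"
  shows "\<exists>w\<in>carrier_vec n. \<exists>g. \<exists>y\<in>carrier_vec n. g \<noteq> 0 \<and> v = g \<cdot>\<^sub>v w \<and> y \<bullet> w = 1"
proof -
  obtain g y where g: "\<forall>i<n. g dvd v $ i" "(\<Sum>i<n. v $ i * y i) = g" using bezout_sum[of n "\<lambda>i. v $ i"] by blast
  have g0: "g \<noteq> 0" using g(1) v by force
  define w where "w = vec n (\<lambda>i. v $ i div g)"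
  have "v = g \<cdot>\<^sub>v w" using v g(1) unfolding w_def by (intro eq_vecI) auto
  moreover have "vec n y \<bullet> w = 1"
  proof -
    have "g * (vec n y \<bullet> w) = (\<Sum>i<n. y i * (g * (v $ i div g)))"
      unfolding w_def by (simp add: scalar_prod_def atLeast0LessThan sum_distrib_left mult_ac)
    also have "\<dots> = g" using g by (simp add: mult_ac)
    finally show ?thesis using g0 by simp
  qed
  ultimately show ?thesis using g0 unfolding w_def by (intro bexI[of _ "vec n (\<lambda>i. v $ i div g)"] exI[of _ g] bexI[of _ "vec n y"]) auto
qed

text \<open>For \<open>v\<close> nonzero this is determined up to sign. Fixing one choice makes it a
  function of \<open>v\<close>, by which matrices can be grouped.\<close>

definition primitive_part :: "int vec \<Rightarrow> int vec" where
  "primitive_part v = (SOME w. \<exists>g y. w \<in> carrier_vec (dim_vec v) \<and> y \<in> carrier_vec (dim_vec v) \<and>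
     g \<noteq> 0 \<and> v = g \<cdot>\<^sub>v w \<and> y \<bullet> w = 1)"

lemma primitive_part:
  assumes "v \<in> carrier_vec n" "i < n" "v $ i \<noteq> 0"
  obtains g y where "primitive_part v \<in> carrier_vec n" "y \<in> carrier_vec n" "g \<noteq> 0"
    "v = g \<cdot>\<^sub>v primitive_part v" "y \<bullet> primitive_part v = 1"
proof -
  have "\<exists>w. \<exists>g y. w \<in> carrier_vec (dim_vec v) \<and> y \<in> carrier_vec (dim_vec v) \<and>
     g \<noteq> 0 \<and> v = g \<cdot>\<^sub>v w \<and> y \<bullet> w = 1"
    using primitive_multiple[OF assms] assms(1) by auto
  from someI_ex[OF this] show ?thesis using that assms(1) unfolding primitive_part_def[symmetric] by auto
qed

text \<open>Column \<open>q\<close> of the adjugate matrix: a generalised cross product of the rows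
  other than \<open>q\<close>, hence a normal vector of their span.\<close>

definition cofactor_vec :: "nat \<Rightarrow> nat \<Rightarrow> int mat \<Rightarrow> int vec" where
  "cofactor_vec n q A = vec n (\<lambda>j. cofactor A q j)"

lemma row_scalar_cofactor_vec:
  assumes A: "A \<in> carrier_mat n n" and "q < n" "i < n"
  shows "row A i \<bullet> cofactor_vec n q A = (if i = q then det A else 0)"
proof -
  have "row A i \<bullet> cofactor_vec n q A = (\<Sum>j<n. A $$ (i, j) * adj_mat A $$ (j, q))"
    using A assms(2,3) unfolding cofactor_vec_def adj_mat_def by (simp add: scalar_prod_def atLeast0LessThan)
  also have "\<dots> = (A * adj_mat A) $$ (i, q)"
    using A adj_mat(1)[OF A] assms(2,3) by (simp add: scalar_prod_def atLeast0LessThan)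
  also have "\<dots> = (if i = q then det A else 0)" unfolding adj_mat(2)[OF A] using assms by simp
  finally show ?thesis .
qed

section \<open>Dyadic count over the normal vector\<close>

text \<open>\<open>2 ^ j\<close> is the largest power of 2 not exceeding the maximal absolute value
  of an entry, which is positive as \<open>w\<close> is nonzero.\<close>

lemma dyadic_size:
  fixes w :: "int vec"
  assumes w: "w \<in> carrier_vec n" "m < n" "w $ m \<noteq> 0" and le: "\<And>i. i < n \<Longrightarrow> \<bar>real_of_int (w $ i)\<bar> < 2 ^ (J + 1)"
  shows "\<exists>j\<le>J. w \<in> int_box n (2 ^ (j + 1)) \<and> (\<exists>m<n. 2 ^ j \<le> \<bar>real_of_int (w $ m)\<bar>)"
proof -
  define X where "X = (\<lambda>i. nat \<bar>w $ i\<bar>) ` {..<n}"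
  have X: "finite X" "X \<noteq> {}" using w(2) unfolding X_def by auto
  define x where "x = Max X"
  have xmax: "nat \<bar>w $ i\<bar> \<le> x" if "i < n" for i unfolding x_def using X that unfolding X_def by (intro Max_ge) auto
  obtain m' where m': "m' < n" "x = nat \<bar>w $ m'\<bar>" using Max_in[OF X] unfolding x_def X_def by auto
  have "x \<ge> 1" using xmax[OF w(2)] w(3) by linarith
  then obtain j where j: "2 ^ j \<le> x" "x < 2 ^ (j + 1)" using ex_power_ivl1[of 2 x] by auto
  have jr: "2 ^ j \<le> real x" using of_nat_mono[OF j(1), where 'a = real] by simp
  have xr: "real x < 2 ^ (j + 1)" using j(2)[folded of_nat_less_iff[where 'a = real]] by simp
  have "real x < 2 ^ (J + 1)" using le[OF m'(1)] m'(2) by simp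
  then have "(2::real) ^ j < 2 ^ (J + 1)" using jr by linarith
  then have "j < J + 1" by (simp only: power_strict_increasing_iff)
  moreover have "\<bar>real_of_int (w $ i)\<bar> \<le> 2 ^ (j + 1)" if "i < n" for i
    using xmax[OF that] xr by linarith
  moreover have "2 ^ j \<le> \<bar>real_of_int (w $ m')\<bar>" using jr m'(2) by simp
  ultimately show ?thesis using w(1) m'(1) unfolding int_box_def by (intro exI[of _ j]) auto
qed

text \<open>Group by the primitive normal vector \<open>w\<close> of the rows other than
  \<open>q\<close>, with largest entry about \<open>2 ^ j\<close>. There are about
  \<open>2 ^ (j * n)\<close> such \<open>w\<close>. Each of these \<open>n - 1\<close> rows lies on
  a hyperplane with about \<open>H ^ (n - 1) / 2 ^ j\<close> points of the box, and row
  \<open>q\<close> lies on one of at most \<open>M\<close> parallel hyperplanes. The powers of 2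
  cancel, and the factor \<open>J + 1\<close> counts the dyadic ranges.\<close>

lemma card_mats_det_fibre_le:
  fixes M :: real
  assumes sub: "\<A> \<subseteq> int_mats n H" and nz: "\<And>A. A \<in> \<A> \<Longrightarrow> det A \<noteq> 0" and q: "q < n" and H: "H \<ge> 1" and M: "M \<ge> 0"
    and fibre: "\<And>A. A \<in> \<A> \<Longrightarrow> real (card (det ` {A' \<in> \<A>. agree_off n q A A'})) \<le> M"
    and J: "fact n * H ^ n < 2 ^ (J + 1)"
  shows "real (card \<A>) \<le> real (J + 1) * (6 * (3 * real (n + 2)) ^ n) ^ n * M * H ^ (n * (n - 1))"
proof -
  define c where "c = (3 * real (n + 2)) ^ n"
  have c0: "c > 0" unfolding c_def by simp
  define P where "P = (\<lambda>A. primitive_part (cofactor_vec n q A))"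
  define W where "W = (\<lambda>j. {w \<in> int_box n (2 ^ (j + 1)). \<exists>m<n. 2 ^ j \<le> \<bar>real_of_int (w $ m)\<bar>})"
  define N where "N = (\<lambda>j. c * H ^ (n - 1) / 2 ^ j)"
  have carr: "A \<in> carrier_mat n n" if "A \<in> \<A>" for A using that sub unfolding int_mats_def by auto
  have finA: "finite \<A>" using sub card_int_mats(1)[OF H] finite_subset by blast
  have cofnz: "\<exists>i<n. cofactor_vec n q A $ i \<noteq> 0" if A: "A \<in> \<A>" for A
  proof (rule ccontr)
    assume "\<not> ?thesis"
    then have "row A q \<bullet> cofactor_vec n q A = 0"
      unfolding scalar_prod_def cofactor_vec_def by auto
    then show False using row_scalar_cofactor_vec[OF carr[OF A] q q] nz[OF A] by simp
  qed
  have prim: "\<exists>g y. P A \<in> carrier_vec n \<and> y \<in> carrier_vec n \<and> g \<noteq> 0 \<and>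
      cofactor_vec n q A = g \<cdot>\<^sub>v P A \<and> y \<bullet> P A = 1" if A: "A \<in> \<A>" for A
  proof -
    obtain i where i: "i < n" "cofactor_vec n q A $ i \<noteq> 0" using cofnz[OF A] by blast
    have "cofactor_vec n q A \<in> carrier_vec n" unfolding cofactor_vec_def by simp
    from primitive_part[OF this i] show ?thesis unfolding P_def by blast
  qed
  have PW: "\<exists>j\<le>J. P A \<in> W j" if A: "A \<in> \<A>" for A
  proof -
    obtain i where i: "i < n" "cofactor_vec n q A $ i \<noteq> 0" using cofnz[OF A] by blast
    obtain g y where g: "P A \<in> carrier_vec n" "g \<noteq> 0" "cofactor_vec n q A = g \<cdot>\<^sub>v P A" using prim[OF A] by blast
    have PAi: "cofactor A q i = g * P A $ i" if "i < n" for i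
      using arg_cong[OF g(3), of "\<lambda>v. v $ i"] that g(1) unfolding cofactor_vec_def by simp
    have "P A $ i \<noteq> 0" using i g PAi[OF i(1)] unfolding cofactor_vec_def by auto
    moreover have "\<bar>real_of_int (P A $ i)\<bar> < 2 ^ (J + 1)" if i: "i < n" for i
    proof -
      \<comment> \<open>As \<open>g\<close> is a nonzero integer, the entries of \<open>P A\<close>
        are at most the cofactors, which lie below \<open>2 ^ (J + 1)\<close>.\<close>
      have "1 * \<bar>P A $ i\<bar> \<le> \<bar>g\<bar> * \<bar>P A $ i\<bar>" using g(2) by (intro mult_right_mono) auto
      then have "\<bar>P A $ i\<bar> \<le> \<bar>cofactor A q i\<bar>" unfolding PAi[OF i] abs_mult by simp
      then have "\<bar>real_of_int (P A $ i)\<bar> \<le> \<bar>real_of_int (cofactor A q i)\<bar>" by linarith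
      also have "\<dots> \<le> fact n * H ^ n" using abs_cofactor_le[of A n H q i] A sub q i H by auto
      finally show ?thesis using J by linarith
    qed
    ultimately show ?thesis using dyadic_size[of "P A" n i J] g(1) i(1) unfolding W_def by auto
  qed
  have hyp: "real (card {x \<in> int_box n H. x \<bullet> P A = k}) \<le> N j" if A: "A \<in> \<A>" and j: "P A \<in> W j" for A j k
  proof -
    obtain g y where g: "P A \<in> carrier_vec n" "y \<in> carrier_vec n" "g \<noteq> 0"
      "cofactor_vec n q A = g \<cdot>\<^sub>v P A" "y \<bullet> P A = 1" using prim[OF A] by blast
    obtain m where m: "m < n" "2 ^ j \<le> \<bar>real_of_int (P A $ m)\<bar>" using j unfolding W_def by auto
    \<comment> \<open>Replacing row \<open>q\<close> by a unit vector leaves its cofactors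
      unchanged, so \<open>det B = g * P A $ m\<close>. This is nonzero, and \<open>B\<close> meets
      the requirements of \<open>card_hyperplane_box_le\<close>.\<close>
    define B where "B = mat n n (\<lambda>(i, k). if i = q then (if k = m then 1 else 0) else A $$ (i, k))"
    have B: "B \<in> carrier_mat n n" unfolding B_def by simp
    have rowB: "row B q = unit_vec n m" unfolding B_def using q m(1) by (intro eq_vecI) (auto simp: unit_vec_def)
    have off: "agree_off n q A B"
      unfolding agree_off_def B_def using carr[OF A] by (auto intro!: eq_vecI)
    have cofB: "cofactor_vec n q B = cofactor_vec n q A"
      unfolding cofactor_vec_def using cofactor_cong_agree_off[OF carr[OF A] B off q] by (intro eq_vecI) auto
    have "det B = unit_vec n m \<bullet> (g \<cdot>\<^sub>v P A)"
      using row_scalar_cofactor_vec[OF B q q] unfolding cofB rowB g(4) by simp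
    also have "\<dots> = g * P A $ m" using m g(1) by simp
    finally have detB: "det B \<noteq> 0" using g(3) m(2) by (auto simp: power_le_zero_eq)
    have "real (card {x \<in> int_box n H. x \<bullet> P A = k}) * (\<bar>real_of_int (P A $ m)\<bar> * H) \<le> (3 * real (n + 2) * H) ^ n"
    proof (rule card_hyperplane_box_le[OF B detB q m(1) rowB _ g(1) _ g(2) g(5) H])
      show "P A $ m \<noteq> 0" using m(2) by (auto simp: power_le_zero_eq)
      fix i assume i: "i < n" "i \<noteq> q"
      have r: "row B i = row A i" using off i unfolding agree_off_def by simp
      have "g * (row A i \<bullet> P A) = row A i \<bullet> (g \<cdot>\<^sub>v P A)"
        using carr[OF A] g(1) i by (simp add: scalar_prod_smult_distrib[of _ n])
      also have "\<dots> = 0" unfolding g(4)[symmetric] using row_scalar_cofactor_vec[OF carr[OF A] q i(1)] i by simp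
      finally show "row B i \<in> int_box n H \<and> row B i \<bullet> P A = 0"
        unfolding r using g(3) A sub i by (auto simp: int_mats_iff_rows)
    qed
    moreover have "real (card {x \<in> int_box n H. x \<bullet> P A = k}) * (2 ^ j * H) \<le>
        real (card {x \<in> int_box n H. x \<bullet> P A = k}) * (\<bar>real_of_int (P A $ m)\<bar> * H)"
      using m(2) H by (intro mult_left_mono mult_right_mono) auto
    ultimately have "real (card {x \<in> int_box n H. x \<bullet> P A = k}) * (2 ^ j * H) \<le> c * H ^ n"
      unfolding c_def by (simp add: power_mult_distrib)
    moreover have "H ^ n = H ^ (n - 1) * H" using q by (cases n) auto
    ultimately have "real (card {x \<in> int_box n H. x \<bullet> P A = k}) * 2 ^ j * H \<le> (c * H ^ (n - 1)) * H"
      by (simp add: mult_ac)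
    then have "real (card {x \<in> int_box n H. x \<bullet> P A = k}) * 2 ^ j \<le> c * H ^ (n - 1)"
      using H by (simp only: mult_le_cancel_right)
    then show ?thesis unfolding N_def by (simp add: field_simps)
  qed
  have N0: "N j \<ge> 0" for j unfolding N_def using c0 H by simp
  have piece: "real (card {A \<in> \<A>. P A = w}) \<le> M * N j ^ n" if w: "w \<in> W j" for w j
  proof (cases "{A \<in> \<A>. P A = w} = {}")
    case True
    show ?thesis unfolding True using M N0 by simp
  next
    case False
    then obtain A0 where A0: "A0 \<in> \<A>" "P A0 = w" by auto
    have cnt: "real (card {x \<in> int_box n H. x \<bullet> w = k}) \<le> N j" for k
      using hyp[OF A0(1), of j k] A0(2) w by simp
    define R where "R = {x \<in> int_box n H. x \<bullet> w = 0}"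
    have finR: "finite {x \<in> int_box n H. x \<bullet> w = k}" for k using card_int_box(1)[OF H, of n] by simp
    have "real (card {A \<in> \<A>. P A = w}) \<le> real (card R) ^ (n - 1) * (M * N j)"
    proof (rule card_mats_by_rows[where q = q])
      fix A i assume A: "A \<in> {A \<in> \<A>. P A = w}" and i: "i < n" "i \<noteq> q"
      obtain g where g: "g \<noteq> 0" "P A \<in> carrier_vec n" "cofactor_vec n q A = g \<cdot>\<^sub>v P A" using prim A by blast
      have cA: "A \<in> carrier_mat n n" using carr A by auto
      have "g * (row A i \<bullet> P A) = row A i \<bullet> (g \<cdot>\<^sub>v P A)"
        using cA g i by (simp add: scalar_prod_smult_distrib[of _ n])
      also have "\<dots> = 0" unfolding g(3)[symmetric] using row_scalar_cofactor_vec[OF cA q i(1)] i by simp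
      finally show "row A i \<in> R" using g(1) A sub i unfolding R_def by (auto simp: int_mats_iff_rows)
    next
      fix A assume "A \<in> {A \<in> \<A>. P A = w}"
      then have A: "A \<in> \<A>" "P A = w" by auto
      obtain g where g: "g \<noteq> 0" "w \<in> carrier_vec n" "cofactor_vec n q A = g \<cdot>\<^sub>v w"
        using prim[OF A(1)] A(2) by blast
      define F where "F = {A' \<in> \<A>. agree_off n q A A'}"
      \<comment> \<open>All matrices of the fibre share \<open>g\<close> and \<open>w\<close>, so
        the value of row \<open>q\<close> at \<open>w\<close> is the determinant divided by
        \<open>g\<close>: at most \<open>M\<close> values.\<close>
      define D where "D = (\<lambda>d. d div g) ` det ` F"
      have "row A' q \<in> (\<Union>k\<in>D. {x \<in> int_box n H. x \<bullet> w = k})" if A': "A' \<in> F" for A'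
      proof -
        have 1: "A' \<in> \<A>" "agree_off n q A A'" using A' unfolding F_def by auto
        have "cofactor_vec n q A' = cofactor_vec n q A"
          unfolding cofactor_vec_def using cofactor_cong_agree_off[OF carr[OF A(1)] carr[OF 1(1)] 1(2) q] by (intro eq_vecI) auto
        then have "row A' q \<bullet> (g \<cdot>\<^sub>v w) = det A'"
          using row_scalar_cofactor_vec[OF carr[OF 1(1)] q q] g(3) by simp
        then have "g * (row A' q \<bullet> w) = det A'"
          using carr[OF 1(1)] g(2) q by (simp add: scalar_prod_smult_distrib[of _ n])
        then have "row A' q \<bullet> w = det A' div g"
          using nonzero_mult_div_cancel_left[OF g(1), of "row A' q \<bullet> w"] by simp
        moreover have "det A' div g \<in> D" unfolding D_def using A' by auto
        moreover have "row A' q \<in> int_box n H" using 1 sub q by (auto simp: int_mats_iff_rows)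
        ultimately show ?thesis by auto
      qed
      then have "(\<lambda>A'. row A' q) ` {A' \<in> {A \<in> \<A>. P A = w}. agree_off n q A A'}
          \<subseteq> (\<Union>k\<in>D. {x \<in> int_box n H. x \<bullet> w = k})" unfolding F_def by blast
      moreover have finD: "finite D" unfolding D_def F_def using finA by simp
      ultimately have "card ((\<lambda>A'. row A' q) ` {A' \<in> {A \<in> \<A>. P A = w}. agree_off n q A A'})
          \<le> card (\<Union>k\<in>D. {x \<in> int_box n H. x \<bullet> w = k})" using finR by (intro card_mono) auto
      also have "\<dots> \<le> (\<Sum>k\<in>D. card {x \<in> int_box n H. x \<bullet> w = k})" by (rule card_UN_le[OF finD])
      finally have "real (card ((\<lambda>A'. row A' q) ` {A' \<in> {A \<in> \<A>. P A = w}. agree_off n q A A'}))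
          \<le> (\<Sum>k\<in>D. real (card {x \<in> int_box n H. x \<bullet> w = k}))" by (simp only: of_nat_sum[symmetric] of_nat_le_iff)
      also have "\<dots> \<le> (\<Sum>k\<in>D. N j)" by (intro sum_mono cnt)
      also have "\<dots> = real (card D) * N j" by simp
      also have "\<dots> \<le> M * N j"
      proof (intro mult_right_mono N0)
        have "card D \<le> card (det ` F)" unfolding D_def F_def using finA by (intro card_image_le) auto
        then show "real (card D) \<le> M" using fibre[OF A(1)] unfolding F_def by linarith
      qed
      finally show "real (card ((\<lambda>A'. row A' q) ` {A' \<in> {A \<in> \<A>. P A = w}. agree_off n q A A'})) \<le> M * N j" .
    qed (use finA carr q M N0 finR in \<open>auto simp: R_def\<close>)
    also have "\<dots> \<le> N j ^ (n - 1) * (M * N j)"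
      using cnt[of 0] M N0 unfolding R_def by (intro mult_right_mono power_mono) auto
    also have "\<dots> = M * N j ^ n" using q by (cases n) auto
    finally show ?thesis .
  qed
  have finW: "finite (W j)" and cardW: "real (card (W j)) \<le> (6 * 2 ^ j) ^ n" for j
  proof -
    have 1: "(1::real) \<le> 2 ^ (j + 1)" by (rule one_le_power) simp
    show "finite (W j)" unfolding W_def using card_int_box(1)[OF 1, of n] by simp
    have "card (W j) \<le> card (int_box n (2 ^ (j + 1)))"
      unfolding W_def using card_int_box(1)[OF 1, of n] by (intro card_mono) auto
    then show "real (card (W j)) \<le> (6 * 2 ^ j) ^ n" using card_int_box(2)[OF 1, of n] by simp
  qed
  have "\<A> \<subseteq> (\<Union>j\<in>{..J}. \<Union>w\<in>W j. {A \<in> \<A>. P A = w})" using PW by blast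
  then have "card \<A> \<le> card (\<Union>j\<in>{..J}. \<Union>w\<in>W j. {A \<in> \<A>. P A = w})"
    using finA finW by (intro card_mono) auto
  also have "\<dots> \<le> (\<Sum>j\<in>{..J}. card (\<Union>w\<in>W j. {A \<in> \<A>. P A = w}))" by (rule card_UN_le) simp
  also have "\<dots> \<le> (\<Sum>j\<in>{..J}. \<Sum>w\<in>W j. card {A \<in> \<A>. P A = w})" by (intro sum_mono card_UN_le finW)
  finally have "real (card \<A>) \<le> real (\<Sum>j\<in>{..J}. \<Sum>w\<in>W j. card {A \<in> \<A>. P A = w})" by (simp only: of_nat_le_iff)
  also have "\<dots> = (\<Sum>j\<in>{..J}. \<Sum>w\<in>W j. real (card {A \<in> \<A>. P A = w}))" by simp
  also have "\<dots> \<le> (\<Sum>j\<in>{..J}. \<Sum>w\<in>W j. M * N j ^ n)" by (intro sum_mono piece)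
  \<comment> \<open>The number of normal vectors, of order \<open>2 ^ (j * n)\<close>, cancels the
    denominator of \<open>N j ^ n\<close>, so the bound is the same for every
    \<open>j\<close>.\<close>
  also have "\<dots> \<le> (\<Sum>j\<in>{..J}. (6 * c) ^ n * M * H ^ (n * (n - 1)))"
  proof (intro sum_mono)
    fix j
    have "(\<Sum>w\<in>W j. M * N j ^ n) = real (card (W j)) * (M * N j ^ n)" by simp
    also have "\<dots> \<le> (6 * 2 ^ j) ^ n * (M * N j ^ n)"
      using M N0 by (intro mult_right_mono cardW) auto
    also have "\<dots> = (6 * c) ^ n * M * H ^ (n * (n - 1))"
      unfolding N_def by (simp add: power_mult_distrib power_divide power_mult[symmetric] mult.commute[of n])
    finally show "(\<Sum>w\<in>W j. M * N j ^ n) \<le> (6 * c) ^ n * M * H ^ (n * (n - 1))" .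
  qed
  also have "\<dots> = real (J + 1) * (6 * c) ^ n * M * H ^ (n * (n - 1))" by simp
  finally show ?thesis unfolding c_def .
qed

section \<open>Matrices with a supported conjugate\<close>

lemma abs_det_int_mats_le: "A \<in> int_mats n H \<Longrightarrow> \<bar>real_of_int (det A)\<bar> \<le> fact n * H ^ n"
  by (rule abs_det_le) (auto simp: int_mats_def)

text \<open>\<open>E\<close> is any integer attached to \<open>A\<close> that does not depend on row
  \<open>q\<close>; it is constant in one application and a multiple of a conjugate entry in the
  other. Once the other rows are fixed, \<open>E A\<close> is a fixed nonzero integer of polynomial
  size, and every prime of \<open>det A\<close> divides it, which leaves few values of
  \<open>det A\<close>.\<close>

lemma card_mats_det_supported_le:
  fixes a e :: real
  assumes e: "e > 0" and n: "n \<ge> 1" and a: "a \<ge> 0"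
  shows "\<exists>C\<ge>0. \<forall>H\<ge>1. \<forall>q<n. \<forall>E :: int mat \<Rightarrow> int.
    (\<forall>A\<in>int_mats n H. \<forall>A'\<in>int_mats n H. agree_off n q A A' \<longrightarrow> E A = E A') \<longrightarrow>
    real (card {A \<in> int_mats n H. det A \<noteq> 0 \<and> E A \<noteq> 0 \<and> \<bar>real_of_int (E A)\<bar> \<le> a * H ^ b \<and>
       (\<forall>p. prime p \<longrightarrow> p dvd det A \<longrightarrow> p dvd E A)}) \<le> C * H powr (real (n * (n - 1)) + e)"
proof -
  \<comment> \<open>Chosen so that \<open>(H ^ (n + b)) powr e' = H powr (e / 2)\<close>. The other
    half of \<open>e\<close> absorbs the logarithmic number of dyadic ranges.\<close>
  define e' where "e' = e / (2 * real (n + b))"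
  have e': "e' > 0" "e' * real (n + b) = e / 2" using e n unfolding e'_def by (auto simp: field_simps)
  obtain C1 where C1: "C1 \<ge> 0" "\<And>X K. X \<ge> 0 \<Longrightarrow> K \<noteq> 0 \<Longrightarrow>
      finite {x::int. x \<noteq> 0 \<and> \<bar>real_of_int x\<bar> \<le> X \<and> (\<forall>p. prime p \<longrightarrow> p dvd x \<longrightarrow> p dvd K)} \<and>
      real (card {x::int. x \<noteq> 0 \<and> \<bar>real_of_int x\<bar> \<le> X \<and> (\<forall>p. prime p \<longrightarrow> p dvd x \<longrightarrow> p dvd K)})
        \<le> C1 * (X * \<bar>real_of_int K\<bar>) powr e'"
    using card_ints_supported_le[OF e'(1)] by blast
  \<comment> \<open>From \<open>ln H \<le> H powr (e / 2) / (e / 2)\<close>, applied to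
    \<open>log 2 (fact n * H ^ n) + 2\<close>, which bounds \<open>J + 1\<close>.\<close>
  define C2 where "C2 = log 2 (fact n) + 2 + real n * (2 / (e * ln 2))"
  have C2: "C2 \<ge> 0" unfolding C2_def using e by (auto intro!: add_nonneg_nonneg)
  define c where "c = (6 * (3 * real (n + 2)) ^ n) ^ n"
  have c: "c \<ge> 0" unfolding c_def by simp
  define C3 where "C3 = C1 * (fact n * a) powr e'"
  have C3: "C3 \<ge> 0" unfolding C3_def using C1(1) by simp
  show ?thesis
  proof (rule exI[of _ "C2 * c * C3"], intro conjI allI impI)
    show "0 \<le> C2 * c * C3" using C2 c C3 by simp
    fix H :: real and q and E :: "int mat \<Rightarrow> int"
    assume H: "1 \<le> H" and q: "q < n"
      and E: "\<forall>A\<in>int_mats n H. \<forall>A'\<in>int_mats n H. agree_off n q A A' \<longrightarrow> E A = E A'"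
    define \<A> where "\<A> = {A \<in> int_mats n H. det A \<noteq> 0 \<and> E A \<noteq> 0 \<and> \<bar>real_of_int (E A)\<bar> \<le> a * H ^ b \<and>
       (\<forall>p. prime p \<longrightarrow> p dvd det A \<longrightarrow> p dvd E A)}"
    define M where "M = C3 * H powr (e / 2)"
    define J where "J = nat \<lceil>log 2 (fact n * H ^ n)\<rceil>"
    have f1: "fact n * H ^ n \<ge> 1"
      using H mult_mono[of 1 "fact n :: real" 1 "H ^ n"] by (simp add: fact_ge_1)
    have Hn: "H ^ k > 0" for k using H by simp
    have J1: "fact n * H ^ n < 2 ^ (J + 1)"
    proof -
      have "fact n * H ^ n = 2 powr log 2 (fact n * H ^ n)" using f1 by simp
      also have "\<dots> \<le> 2 powr real J" unfolding J_def by (intro powr_mono) (auto, linarith)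
      also have "\<dots> = 2 ^ J" by (simp add: powr_realpow)
      also have "\<dots> < 2 ^ (J + 1)" by simp
      finally show ?thesis .
    qed
    have J2: "real (J + 1) \<le> C2 * H powr (e / 2)"
    proof -
      have "log 2 (fact n * H ^ n) \<ge> 0" using f1 by (simp add: zero_le_log_cancel_iff)
      then have "real (J + 1) \<le> log 2 (fact n * H ^ n) + 2" unfolding J_def by linarith
      also have "\<dots> = log 2 (fact n) + 2 + real n * (ln H / ln 2)"
        using H Hn[of n] by (simp add: log_def ln_mult ln_realpow add_divide_distrib)
      also have "\<dots> \<le> (log 2 (fact n) + 2) * H powr (e / 2) + real n * ((H powr (e / 2) / (e / 2)) / ln 2)"
      proof (intro add_mono mult_left_mono divide_right_mono)
        have "(log 2 (fact n) + 2) * 1 \<le> (log 2 (fact n) + 2) * H powr (e / 2)"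
          using H e by (intro mult_left_mono ge_one_powr_ge_zero) (auto intro!: add_nonneg_nonneg simp: fact_ge_1)
        then show "log 2 (fact n) + 2 \<le> (log 2 (fact n) + 2) * H powr (e / 2)" by simp
        show "ln H \<le> H powr (e / 2) / (e / 2)" using H e by (intro ln_powr_bound) auto
      qed auto
      also have "\<dots> = C2 * H powr (e / 2)" unfolding C2_def using e by (simp add: field_simps)
      finally show ?thesis .
    qed
    have fib: "real (card (det ` {A' \<in> \<A>. agree_off n q A A'})) \<le> M" if A: "A \<in> \<A>" for A
    proof -
      define Z where "Z = {x::int. x \<noteq> 0 \<and> \<bar>real_of_int x\<bar> \<le> fact n * H ^ n \<and> (\<forall>p. prime p \<longrightarrow> p dvd x \<longrightarrow> p dvd E A)}"
      have EA: "E A \<noteq> 0" "\<bar>real_of_int (E A)\<bar> \<le> a * H ^ b" using A unfolding \<A>_def by auto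
      have Z: "finite Z" "real (card Z) \<le> C1 * (fact n * H ^ n * \<bar>real_of_int (E A)\<bar>) powr e'"
        using C1(2)[of "fact n * H ^ n" "E A"] f1 EA(1) unfolding Z_def by auto
      have "det ` {A' \<in> \<A>. agree_off n q A A'} \<subseteq> Z"
      proof clarify
        fix A' assume A': "A' \<in> \<A>" "agree_off n q A A'"
        then have "E A = E A'" using E A unfolding \<A>_def by blast
        then show "det A' \<in> Z" using A' abs_det_int_mats_le[of A' n H] unfolding Z_def \<A>_def by auto
      qed
      then have "real (card (det ` {A' \<in> \<A>. agree_off n q A A'})) \<le> real (card Z)"
        using card_mono[OF Z(1)] by simp
      also have "\<dots> \<le> C1 * (fact n * H ^ n * (a * H ^ b)) powr e'"
        by (rule order_trans[OF Z(2)]) (use C1(1) EA(2) e' H in \<open>auto intro!: mult_left_mono powr_mono2\<close>)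
      also have "fact n * H ^ n * (a * H ^ b) = (fact n * a) * H ^ (n + b)" by (simp add: power_add mult_ac)
      also have "C1 * ((fact n * a) * H ^ (n + b)) powr e' = C3 * (H ^ (n + b)) powr e'"
        unfolding C3_def using a H by (simp add: powr_mult)
      also have "(H ^ (n + b)) powr e' = H powr (e / 2)"
      proof -
        have "(H ^ (n + b)) powr e' = H powr (real (n + b) * e')"
          using H by (simp only: powr_realpow[symmetric] powr_powr)
        then show ?thesis using e'(2) by (simp only: mult.commute)
      qed
      finally show ?thesis unfolding M_def .
    qed
    have "real (card \<A>) \<le> real (J + 1) * c * M * H ^ (n * (n - 1))"
      unfolding c_def
      by (rule card_mats_det_fibre_le[OF _ _ q H _ fib J1]) (use C3 in \<open>auto simp: \<A>_def M_def\<close>)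
    also have "\<dots> \<le> (C2 * H powr (e / 2)) * c * M * H ^ (n * (n - 1))"
      using J2 c C3 H by (intro mult_right_mono) (auto simp: M_def)
    also have "\<dots> = C2 * c * C3 * (H powr (e / 2) * H powr (e / 2) * H powr real (n * (n - 1)))"
      unfolding M_def using H by (simp add: powr_realpow del: of_nat_mult)
    also have "H powr (e / 2) * H powr (e / 2) * H powr real (n * (n - 1)) = H powr (real (n * (n - 1)) + e)"
      by (simp add: powr_add[symmetric] add.commute del: of_nat_mult)
    finally show "real (card {A \<in> int_mats n H. det A \<noteq> 0 \<and> E A \<noteq> 0 \<and> \<bar>real_of_int (E A)\<bar> \<le> a * H ^ b \<and>
       (\<forall>p. prime p \<longrightarrow> p dvd det A \<longrightarrow> p dvd E A)}) \<le> C2 * c * C3 * H powr (real (n * (n - 1)) + e)"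
      unfolding \<A>_def .
  qed
qed

section \<open>Left eigenvectors in a box\<close>

lemma card_box_coordinate_fibre_le:
  fixes M :: real
  assumes X: "X \<subseteq> int_box n H" and k: "k < n" and H: "H \<ge> 1" and M: "M \<ge> 0"
    and fibre: "\<And>v. v \<in> X \<Longrightarrow>
      real (card ((\<lambda>v'. v' $ k) ` {v' \<in> X. \<forall>i<n. i \<noteq> k \<longrightarrow> v' $ i = v $ i})) \<le> M"
  shows "real (card X) \<le> (3 * H) ^ (n - 1) * M"
proof -
  define I where "I = {c::int. \<bar>real_of_int c\<bar> \<le> H}"
  have I: "finite I" "real (card I) \<le> 3 * H" using card_int_interval[of H] H unfolding I_def by auto
  define f where "f = (\<lambda>v::int vec. restrict (\<lambda>i. v $ i) ({..<n} - {k}))"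
  have f: "f v' = f v \<longleftrightarrow> (\<forall>i<n. i \<noteq> k \<longrightarrow> v' $ i = v $ i)" for v v'
    unfolding f_def restrict_def by (auto simp: fun_eq_iff)
  have finX: "finite X" using X card_int_box(1)[OF H] finite_subset by blast
  have "real (card X) \<le> real (card (({..<n} - {k}) \<rightarrow>\<^sub>E I)) * M"
  proof (rule card_le_fibres[where f = f])
    show "f ` X \<subseteq> ({..<n} - {k}) \<rightarrow>\<^sub>E I"
      using X unfolding f_def int_box_def I_def by (auto simp: PiE_iff restrict_def split: if_splits)
    fix v assume v: "v \<in> X"
    have "inj_on (\<lambda>v'. v' $ k) {v' \<in> X. \<forall>i<n. i \<noteq> k \<longrightarrow> v' $ i = v $ i}"
    proof (rule inj_onI)
      fix x y assume x: "x \<in> {v' \<in> X. \<forall>i<n. i \<noteq> k \<longrightarrow> v' $ i = v $ i}"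
        and y: "y \<in> {v' \<in> X. \<forall>i<n. i \<noteq> k \<longrightarrow> v' $ i = v $ i}" and eq: "x $ k = y $ k"
      have "x \<in> carrier_vec n" "y \<in> carrier_vec n" using x y X unfolding int_box_def by auto
      moreover have "x $ i = y $ i" if "i < n" for i using x y eq that by (cases "i = k") auto
      ultimately show "x = y" by (intro eq_vecI) auto
    qed
    then show "real (card {a' \<in> X. f a' = f v}) \<le> M"
      using fibre[OF v] unfolding f by (simp add: card_image)
  qed (use finX I M in \<open>auto intro: finite_PiE\<close>)
  also have "real (card (({..<n} - {k}) \<rightarrow>\<^sub>E I)) = real (card I) ^ (n - 1)"
    using k by (simp add: card_PiE)
  also have "\<dots> * M \<le> (3 * H) ^ (n - 1) * M" using I M by (intro mult_right_mono power_mono) auto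
  finally show ?thesis .
qed

lemma card_box_zero_coordinate_le:
  assumes k: "k < n" and H: "H \<ge> 1"
  shows "real (card {v \<in> int_box n H. v $ k = 0}) \<le> (3 * H) ^ (n - 1)"
proof -
  have "real (card {v \<in> int_box n H. v $ k = 0}) \<le> (3 * H) ^ (n - 1) * 1"
  proof (rule card_box_coordinate_fibre_le[OF _ k H])
    fix v
    have "card ((\<lambda>v'. v' $ k) ` {v' \<in> {v \<in> int_box n H. v $ k = 0}. \<forall>i<n. i \<noteq> k \<longrightarrow> v' $ i = v $ i}) \<le> card {0::int}"
      by (intro card_mono) auto
    then show "real (card ((\<lambda>v'. v' $ k) ` {v' \<in> {v \<in> int_box n H. v $ k = 0}. \<forall>i<n. i \<noteq> k \<longrightarrow> v' $ i = v $ i})) \<le> 1"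
      by simp
  qed auto
  then show ?thesis by simp
qed

text \<open>\<open>v \<bullet> col B l\<close> is entry \<open>l\<close> of the row vector
  \<open>v B\<close>. The equations are the 2 by 2 minors of the rows \<open>v B\<close> and
  \<open>v\<close>, so proportionality is expressed without an eigenvalue.\<close>

definition left_eigvecs :: "nat \<Rightarrow> real \<Rightarrow> int mat \<Rightarrow> int vec set" where
  "left_eigvecs n H B = {v \<in> int_box n H. \<forall>k<n. \<forall>l<n. (v \<bullet> col B l) * v $ k = (v \<bullet> col B k) * v $ l}"

text \<open>If \<open>B\<close> has a nonzero off-diagonal entry, one minor is a genuine quadratic
  equation for one coordinate, leaving two choices. If \<open>B\<close> is diagonal but not scalar,
  one of two coordinates must vanish. Either way a factor \<open>H\<close> is lost.\<close>

lemma card_left_eigvecs_le: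
  assumes B: "B \<in> carrier_mat n n" "\<And>c. B \<noteq> c \<cdot>\<^sub>m 1\<^sub>m n" and H: "H \<ge> 1"
  shows "real (card (left_eigvecs n H B)) \<le> 2 * (3 * H) ^ (n - 1)"
proof (cases "\<exists>k<n. \<exists>l<n. k \<noteq> l \<and> B $$ (k, l) \<noteq> 0")
  case True
  then obtain k l where kl: "k < n" "l < n" "k \<noteq> l" "B $$ (k, l) \<noteq> 0" by blast
  have "real (card (left_eigvecs n H B)) \<le> (3 * H) ^ (n - 1) * 2"
  proof (rule card_box_coordinate_fibre_le[OF _ kl(1) H])
    show "left_eigvecs n H B \<subseteq> int_box n H" unfolding left_eigvecs_def by auto
    fix v assume v: "v \<in> left_eigvecs n H B"
    \<comment> \<open>The part of \<open>v B\<close> that does not involve coordinate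
      \<open>k\<close>, constant on the fibre. In terms of \<open>x = v' $ k\<close>, the minor for
      \<open>k\<close> and \<open>l\<close> is the polynomial \<open>p\<close>, with leading
      coefficient \<open>B $$ (k, l)\<close>.\<close>
    define s where "s = (\<lambda>l. \<Sum>i\<in>{..<n} - {k}. v $ i * B $$ (i, l))"
    define p where "p = [: - (s k * v $ l), s l - B $$ (k, k) * v $ l, B $$ (k, l) :]"
    have p: "p \<noteq> 0" "degree p \<le> 2" using kl(4) unfolding p_def by auto
    have "poly p (v' $ k) = 0" if v': "v' \<in> left_eigvecs n H B" "\<forall>i<n. i \<noteq> k \<longrightarrow> v' $ i = v $ i" for v'
    proof -
      have c: "v' \<in> carrier_vec n" using v'(1) unfolding left_eigvecs_def int_box_def by auto
      have vB: "v' \<bullet> col B j = v' $ k * B $$ (k, j) + s j" if j: "j < n" for j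
      proof -
        have "v' \<bullet> col B j = (\<Sum>i<n. v' $ i * B $$ (i, j))"
          using B(1) j by (simp add: scalar_prod_def atLeast0LessThan)
        also have "\<dots> = v' $ k * B $$ (k, j) + (\<Sum>i\<in>{..<n} - {k}. v' $ i * B $$ (i, j))"
          using kl(1) by (simp add: sum.remove)
        also have "(\<Sum>i\<in>{..<n} - {k}. v' $ i * B $$ (i, j)) = s j"
          unfolding s_def using v'(2) by (intro sum.cong) auto
        finally show ?thesis .
      qed
      have "(v' \<bullet> col B l) * v' $ k = (v' \<bullet> col B k) * v' $ l"
        using v'(1) kl unfolding left_eigvecs_def by auto
      moreover have "v' $ l = v $ l" using v'(2) kl by auto
      ultimately show ?thesis unfolding p_def using vB kl by (simp add: algebra_simps)
    qed
    then have "(\<lambda>v'. v' $ k) ` {v' \<in> left_eigvecs n H B. \<forall>i<n. i \<noteq> k \<longrightarrow> v' $ i = v $ i} \<subseteq> {x. poly p x = 0}"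
      by blast
    from card_mono[OF poly_roots_finite[OF p(1)] this]
    show "real (card ((\<lambda>v'. v' $ k) ` {v' \<in> left_eigvecs n H B. \<forall>i<n. i \<noteq> k \<longrightarrow> v' $ i = v $ i})) \<le> 2"
      using card_poly_roots_bound[OF p(1)] p(2) by linarith
  qed auto
  then show ?thesis by simp
next
  case False
  \<comment> \<open>Now \<open>B\<close> is diagonal; not being scalar, it has two distinct diagonal
    entries, and their minor gives \<open>v $ k * v $ l = 0\<close>.\<close>
  have "\<exists>k<n. \<exists>l<n. B $$ (k, k) \<noteq> B $$ (l, l)"
  proof (rule ccontr)
    assume "\<not> ?thesis"
    then have d: "B $$ (k, k) = B $$ (0, 0)" if "k < n" for k using that by (metis gr_zeroI not_less0)
    have "B = B $$ (0, 0) \<cdot>\<^sub>m 1\<^sub>m n"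
    proof (rule eq_matI)
      fix i j assume "i < dim_row (B $$ (0, 0) \<cdot>\<^sub>m 1\<^sub>m n)" "j < dim_col (B $$ (0, 0) \<cdot>\<^sub>m 1\<^sub>m n)"
      then show "B $$ (i, j) = (B $$ (0, 0) \<cdot>\<^sub>m 1\<^sub>m n) $$ (i, j)"
        using False d[of i] by auto
    qed (use B in auto)
    then show False using B(2) by blast
  qed
  then obtain k l where kl: "k < n" "l < n" "B $$ (k, k) \<noteq> B $$ (l, l)" by blast
  have "v $ k = 0 \<or> v $ l = 0" if v: "v \<in> left_eigvecs n H B" for v
  proof -
    have c: "v \<in> carrier_vec n" using v unfolding left_eigvecs_def int_box_def by auto
    have vB: "v \<bullet> col B j = v $ j * B $$ (j, j)" if j: "j < n" for j
    proof -
      have "v \<bullet> col B j = (\<Sum>i<n. v $ i * B $$ (i, j))"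
        using B(1) j by (simp add: scalar_prod_def atLeast0LessThan)
      also have "\<dots> = (\<Sum>i<n. if i = j then v $ j * B $$ (j, j) else 0)"
        using False j by (intro sum.cong) auto
      finally show ?thesis using j by simp
    qed
    have "(v \<bullet> col B l) * v $ k = (v \<bullet> col B k) * v $ l"
      using v kl unfolding left_eigvecs_def by auto
    then have "v $ k * v $ l * (B $$ (k, k) - B $$ (l, l)) = 0" using vB kl by (simp add: algebra_simps)
    then show ?thesis using kl(3) by simp
  qed
  then have "left_eigvecs n H B \<subseteq> {v \<in> int_box n H. v $ k = 0} \<union> {v \<in> int_box n H. v $ l = 0}"
    unfolding left_eigvecs_def by auto
  then have "card (left_eigvecs n H B) \<le> card ({v \<in> int_box n H. v $ k = 0} \<union> {v \<in> int_box n H. v $ l = 0})"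
    using card_int_box(1)[OF H, of n] by (intro card_mono) auto
  also have "\<dots> \<le> card {v \<in> int_box n H. v $ k = 0} + card {v \<in> int_box n H. v $ l = 0}" by (rule card_Un_le)
  finally show ?thesis
    using card_box_zero_coordinate_le[OF kl(1) H] card_box_zero_coordinate_le[OF kl(2) H] by linarith
qed

text \<open>The \<open>(i, j)\<close> entry of \<open>A * B * adj_mat A\<close>.\<close>
definition conj_entry :: "nat \<Rightarrow> int mat \<Rightarrow> int mat \<Rightarrow> nat \<Rightarrow> nat \<Rightarrow> int" where
  "conj_entry n B A i j = row (A * B) i \<bullet> cofactor_vec n j A"

text \<open>The entry is built from row \<open>i\<close> of \<open>A\<close> and the cofactors along
  row \<open>j\<close>; for \<open>i \<noteq> j\<close> neither contains row
  \<open>j\<close>.\<close>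

lemma conj_entry_agree_off:
  assumes A: "A \<in> carrier_mat n n" "A' \<in> carrier_mat n n" "agree_off n j A A'" and B: "B \<in> carrier_mat n n"
    and ij: "i < n" "j < n" "i \<noteq> j"
  shows "conj_entry n B A i j = conj_entry n B A' i j"
proof -
  have "cofactor_vec n j A = cofactor_vec n j A'"
    unfolding cofactor_vec_def using cofactor_cong_agree_off[OF A ij(2)] by (intro eq_vecI) auto
  moreover have "row A i = row A' i" using A(3) ij unfolding agree_off_def by auto
  then have "row (A * B) i = row (A' * B) i" using A B ij by (intro eq_vecI) auto
  ultimately show ?thesis unfolding conj_entry_def by simp
qed

lemma abs_conj_entry_le:
  assumes A: "A \<in> int_mats n H" and B: "B \<in> int_mats n H" and ij: "i < n" "j < n" and H: "H \<ge> 1"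
  shows "\<bar>real_of_int (conj_entry n B A i j)\<bar> \<le> real n ^ 2 * fact n * H ^ (n + 2)"
proof -
  have c: "A \<in> carrier_mat n n" "B \<in> carrier_mat n n" using A B unfolding int_mats_def by auto
  have r: "\<bar>real_of_int (row (A * B) i $ l)\<bar> \<le> real n * (H * H)" if l: "l < n" for l
  proof -
    have "row (A * B) i $ l = (\<Sum>k<n. A $$ (i, k) * B $$ (k, l))"
      using c ij l by (simp add: scalar_prod_def atLeast0LessThan)
    then have "\<bar>real_of_int (row (A * B) i $ l)\<bar> \<le> (\<Sum>k<n. \<bar>real_of_int (A $$ (i, k) * B $$ (k, l))\<bar>)"
      by (simp only: of_int_sum) (rule sum_abs)
    also have "\<dots> \<le> (\<Sum>k<n. H * H)"
      using A B ij l H unfolding int_mats_def by (intro sum_mono) (auto simp: abs_mult intro!: mult_mono)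
    finally show ?thesis by simp
  qed
  have "conj_entry n B A i j = (\<Sum>l<n. row (A * B) i $ l * cofactor A j l)"
    unfolding conj_entry_def cofactor_vec_def by (simp add: scalar_prod_def atLeast0LessThan)
  then have "\<bar>real_of_int (conj_entry n B A i j)\<bar> \<le> (\<Sum>l<n. \<bar>real_of_int (row (A * B) i $ l * cofactor A j l)\<bar>)"
    by (simp only: of_int_sum) (rule sum_abs)
  also have "\<dots> \<le> (\<Sum>l<n. (real n * (H * H)) * (fact n * H ^ n))"
    using abs_cofactor_le[OF A ij(2) _ H] r H
    by (intro sum_mono) (auto simp: abs_mult simp del: index_row intro!: mult_mono)
  also have "\<dots> = real n ^ 2 * fact n * H ^ (n + 2)"
    by (simp add: power2_eq_square power_add mult_ac)
  finally show ?thesis .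
qed

text \<open>Multiply \<open>A * B * adj_mat A\<close> on the right by \<open>A\<close>: if its row
  \<open>i\<close> vanishes off the diagonal, then \<open>det A\<close> times row \<open>i\<close>
  of \<open>A * B\<close> is a multiple of row \<open>i\<close> of \<open>A\<close>.\<close>

lemma row_left_eigvec:
  assumes A: "A \<in> int_mats n H" "det A \<noteq> 0" and B: "B \<in> carrier_mat n n" and i: "i < n"
    and zero: "\<And>j. j < n \<Longrightarrow> j \<noteq> i \<Longrightarrow> conj_entry n B A i j = 0"
  shows "row A i \<in> left_eigvecs n H B"
proof -
  have c: "A \<in> carrier_mat n n" using A(1) unfolding int_mats_def by auto
  define r where "r = row (A * B) i"
  define t where "t = conj_entry n B A i i"
  have r: "det A * r $ l = t * A $$ (i, l)" if l: "l < n" for l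
  proof -
    have adj: "(\<Sum>j<n. cofactor A j k * A $$ (j, l)) = (if k = l then det A else 0)" if k: "k < n" for k
    proof -
      have "(\<Sum>j<n. cofactor A j k * A $$ (j, l)) = (adj_mat A * A) $$ (k, l)"
        using c adj_mat(1)[OF c] k l by (simp add: scalar_prod_def atLeast0LessThan adj_mat_def)
      also have "\<dots> = (if k = l then det A else 0)" unfolding adj_mat(3)[OF c] using k l by simp
      finally show ?thesis .
    qed
    have "t * A $$ (i, l) = (\<Sum>j<n. if j = i then t * A $$ (i, l) else 0)" using i by simp
    also have "\<dots> = (\<Sum>j<n. conj_entry n B A i j * A $$ (j, l))"
      using zero by (intro sum.cong) (auto simp: t_def)
    also have "\<dots> = (\<Sum>j<n. \<Sum>k<n. r $ k * (cofactor A j k * A $$ (j, l)))"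
      unfolding conj_entry_def cofactor_vec_def r_def[symmetric]
      by (simp add: scalar_prod_def atLeast0LessThan sum_distrib_right mult.assoc)
    also have "\<dots> = (\<Sum>k<n. r $ k * (\<Sum>j<n. cofactor A j k * A $$ (j, l)))"
      by (subst sum.swap) (simp add: sum_distrib_left)
    also have "\<dots> = (\<Sum>k<n. if k = l then r $ k * det A else 0)" by (intro sum.cong) (auto simp: adj)
    finally show ?thesis using l by simp
  qed
  have rl: "r $ l = row A i \<bullet> col B l" if "l < n" for l unfolding r_def using c B i that by simp
  have "(row A i \<bullet> col B l) * row A i $ k = (row A i \<bullet> col B k) * row A i $ l" if kl: "k < n" "l < n" for k l
  proof -
    have "det A * (r $ l * A $$ (i, k)) = det A * (r $ k * A $$ (i, l))"
      using r[OF kl(1)] r[OF kl(2)] by (metis mult.assoc mult.left_commute mult.commute)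
    then show ?thesis using A(2) c i kl by (simp add: rl)
  qed
  moreover have "row A i \<in> int_box n H" using A(1) i by (auto simp: int_mats_iff_rows)
  ultimately show ?thesis unfolding left_eigvecs_def by blast
qed

section \<open>Matrices constrained by a commutator\<close>

text \<open>The condition that a commutator with \<open>B\<close> imposes on \<open>A\<close>. It is
  stated for off-diagonal entries, each of which is independent of one row of
  \<open>A\<close>.\<close>

definition conj_supported :: "nat \<Rightarrow> real \<Rightarrow> int \<Rightarrow> int mat \<Rightarrow> int mat set" where
  "conj_supported n H K B = {A \<in> int_mats n H. det A \<noteq> 0 \<and>
     (\<forall>i<n. \<forall>j<n. i \<noteq> j \<longrightarrow> (\<forall>p. prime p \<longrightarrow> p dvd det A \<longrightarrow> p dvd K * conj_entry n B A i j))}"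

lemma card_conj_supported_le:
  fixes a e :: real
  assumes e: "e > 0" and n: "n \<ge> 1" and a: "a \<ge> 0"
  shows "\<exists>C\<ge>0. \<forall>H\<ge>1. \<forall>B\<in>int_mats n H. \<forall>K. (\<forall>c. B \<noteq> c \<cdot>\<^sub>m 1\<^sub>m n) \<longrightarrow> K \<noteq> 0 \<longrightarrow> \<bar>real_of_int K\<bar> \<le> a * H ^ b \<longrightarrow>
    real (card (conj_supported n H K B)) \<le> C * H powr (real (n * (n - 1)) + e)"
proof -
  \<comment> \<open>\<open>a' * H ^ b'\<close> bounds \<open>K\<close> times a conjugate entry: it
    is the product of the bounds for both factors.\<close>
  define a' where "a' = a * (real n ^ 2 * fact n)"
  define b' where "b' = b + (n + 2)"
  have a': "a' \<ge> 0" using a unfolding a'_def by simp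
  obtain C where C: "C \<ge> 0" "\<And>H q E. H \<ge> 1 \<Longrightarrow> q < n \<Longrightarrow>
    (\<forall>A\<in>int_mats n H. \<forall>A'\<in>int_mats n H. agree_off n q A A' \<longrightarrow> E A = E A') \<Longrightarrow>
    real (card {A \<in> int_mats n H. det A \<noteq> 0 \<and> E A \<noteq> 0 \<and> \<bar>real_of_int (E A)\<bar> \<le> a' * H ^ b' \<and>
       (\<forall>p. prime p \<longrightarrow> p dvd det A \<longrightarrow> p dvd E A)}) \<le> C * H powr (real (n * (n - 1)) + e)"
    using card_mats_det_supported_le[OF e n a', of b'] by blast
  define C' where "C' = real n * (real n * C) + (2 * 3 ^ (n - 1)) ^ n"
  show ?thesis
  proof (rule exI[of _ C'], intro conjI allI ballI impI)
    show "0 \<le> C'" using C(1) unfolding C'_def by simp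
    fix H :: real and B K
    assume H: "1 \<le> H" and B: "B \<in> int_mats n H" "\<forall>c. B \<noteq> c \<cdot>\<^sub>m 1\<^sub>m n"
      and K: "K \<noteq> 0" "\<bar>real_of_int K\<bar> \<le> a * H ^ b"
    have cB: "B \<in> carrier_mat n n" using B(1) unfolding int_mats_def by auto
    define E where "E = (\<lambda>i j A. K * conj_entry n B A i j)"
    \<comment> \<open>Matrices whose entry \<open>(i, j)\<close> of the conjugate is nonzero, to
      which \<open>card_mats_det_supported_le\<close> applies with \<open>q = j\<close>. The value
      is empty on the diagonal, so unions can run over all pairs.\<close>
    define S where "S = (\<lambda>i j. if i = j then {} else {A \<in> int_mats n H. det A \<noteq> 0 \<and> E i j A \<noteq> 0 \<and>
       \<bar>real_of_int (E i j A)\<bar> \<le> a' * H ^ b' \<and> (\<forall>p. prime p \<longrightarrow> p dvd det A \<longrightarrow> p dvd E i j A)})"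
    define S0 where "S0 = {A \<in> int_mats n H. \<forall>i<n. row A i \<in> left_eigvecs n H B}"
    define X where "X = H powr (real (n * (n - 1)) + e)"
    have finM: "finite (int_mats n H)" by (rule card_int_mats(1)[OF H])
    have finS: "finite (S i j)" "finite S0" for i j using finM unfolding S_def S0_def by auto
    have cS: "real (card (S i j)) \<le> C * X" if ij: "i < n" "j < n" for i j
    proof (cases "i = j")
      case True then show ?thesis unfolding S_def X_def using C(1) by simp
    next
      case False
      have "\<forall>A\<in>int_mats n H. \<forall>A'\<in>int_mats n H. agree_off n j A A' \<longrightarrow> E i j A = E i j A'"
        unfolding E_def using conj_entry_agree_off[OF _ _ _ cB ij False] by (auto simp: int_mats_def)
      from C(2)[OF H ij(2) this] show ?thesis using False unfolding S_def X_def by simp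
    qed
    have cS0: "real (card S0) \<le> (2 * 3 ^ (n - 1)) ^ n * X"
    proof -
      \<comment> \<open>Each of the \<open>n\<close> rows has only about \<open>H ^ (n - 1)\<close>
        choices, which gives the same exponent as for the sets \<open>S i j\<close>.\<close>
      define R where "R = left_eigvecs n H B"
      have finR: "finite R" using card_int_box(1)[OF H, of n] unfolding R_def left_eigvecs_def by simp
      have "real (card S0) \<le> real (card R) ^ (n - 1) * real (card R)"
      proof (rule card_mats_by_rows[where q = 0])
        fix A
        have "(\<lambda>A'. row A' 0) ` {A' \<in> S0. agree_off n 0 A A'} \<subseteq> R" using n unfolding S0_def R_def by auto
        then show "real (card ((\<lambda>A'. row A' 0) ` {A' \<in> S0. agree_off n 0 A A'})) \<le> real (card R)"
          using finR by (simp add: card_mono)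
      qed (use finS finR n in \<open>auto simp: S0_def R_def int_mats_def\<close>)
      also have "\<dots> = real (card R) ^ n" using n by (cases n) auto
      also have "\<dots> \<le> (2 * (3 * H) ^ (n - 1)) ^ n"
        using card_left_eigvecs_le[OF cB _ H] B(2) unfolding R_def by (intro power_mono) auto
      also have "\<dots> = (2 * 3 ^ (n - 1)) ^ n * H ^ (n * (n - 1))"
        by (simp add: power_mult_distrib power_mult[symmetric] mult_ac)
      also have "\<dots> \<le> (2 * 3 ^ (n - 1)) ^ n * X"
        unfolding X_def using H e by (subst powr_realpow[symmetric]) (auto intro!: mult_left_mono powr_mono simp del: of_nat_mult)
      finally show ?thesis .
    qed
    have "conj_supported n H K B \<subseteq> (\<Union>i\<in>{..<n}. \<Union>j\<in>{..<n}. S i j) \<union> S0"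
    proof
      fix A assume A: "A \<in> conj_supported n H K B"
      then have A1: "A \<in> int_mats n H" "det A \<noteq> 0" unfolding conj_supported_def by auto
      show "A \<in> (\<Union>i\<in>{..<n}. \<Union>j\<in>{..<n}. S i j) \<union> S0"
      proof (cases "\<exists>i<n. \<exists>j<n. i \<noteq> j \<and> conj_entry n B A i j \<noteq> 0")
        case True
        then obtain i j where ij: "i < n" "j < n" "i \<noteq> j" "conj_entry n B A i j \<noteq> 0" by blast
        have "\<bar>real_of_int (E i j A)\<bar> \<le> (a * H ^ b) * (real n ^ 2 * fact n * H ^ (n + 2))"
          unfolding E_def of_int_mult abs_mult
          using abs_conj_entry_le[OF A1(1) B(1) ij(1,2) H] K(2) a H by (intro mult_mono) auto
        also have "\<dots> = a' * H ^ b'" unfolding a'_def b'_def by (simp add: power_add mult_ac)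
        finally have "A \<in> S i j"
          using A A1 ij K(1) unfolding S_def E_def conj_supported_def by auto
        then show ?thesis using ij by blast
      next
        case False
        then have "row A i \<in> left_eigvecs n H B" if "i < n" for i
          using row_left_eigvec[OF A1 cB that] that by metis
        then show ?thesis using A1 unfolding S0_def by auto
      qed
    qed
    then have "card (conj_supported n H K B) \<le> card ((\<Union>i\<in>{..<n}. \<Union>j\<in>{..<n}. S i j) \<union> S0)"
      using finS by (intro card_mono) auto
    also have "\<dots> \<le> card (\<Union>i\<in>{..<n}. \<Union>j\<in>{..<n}. S i j) + card S0" by (rule card_Un_le)
    also have "card (\<Union>i\<in>{..<n}. \<Union>j\<in>{..<n}. S i j) \<le> (\<Sum>i<n. card (\<Union>j\<in>{..<n}. S i j))"
      by (rule card_UN_le) simp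
    also have "\<dots> \<le> (\<Sum>i<n. \<Sum>j<n. card (S i j))" by (intro sum_mono card_UN_le) simp
    finally have "real (card (conj_supported n H K B)) \<le> real ((\<Sum>i<n. \<Sum>j<n. card (S i j)) + card S0)"
      by (simp only: of_nat_le_iff add_le_mono)
    also have "\<dots> = (\<Sum>i<n. \<Sum>j<n. real (card (S i j))) + real (card S0)" by simp
    also have "\<dots> \<le> (\<Sum>i<n. \<Sum>j<n. C * X) + (2 * 3 ^ (n - 1)) ^ n * X"
      using cS by (intro add_mono sum_mono cS0) auto
    also have "\<dots> = C' * X" unfolding C'_def by (simp add: algebra_simps)
    finally show "real (card (conj_supported n H K B)) \<le> C' * H powr (real (n * (n - 1)) + e)"
      unfolding X_def .
  qed
qed

section \<open>Commutators in the product of cyclic groups\<close>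

abbreviation rat_mat :: "int mat \<Rightarrow> rat mat" where "rat_mat \<equiv> map_mat rat_of_int"

lemma GL_rat_simps:
  "mult (GL_rat n) = (*)" "one (GL_rat n) = 1\<^sub>m n"
  "carrier (GL_rat n) = {A \<in> carrier_mat n n. \<exists>B\<in>carrier_mat n n. B * A = 1\<^sub>m n \<and> A * B = 1\<^sub>m n}"
  unfolding GL_rat_def units_of_def Units_def by (auto simp: ring_mat_def)

lemma group_GL_rat: "group (GL_rat n)"
proof -
  interpret ring "ring_mat TYPE(rat) n ()" by (rule ring_mat)
  show ?thesis unfolding GL_rat_def by (rule units_group)
qed

lemma det_GL_rat_inv:
  assumes "A \<in> carrier (GL_rat n)"
  shows "det A \<noteq> 0" "det (inv\<^bsub>GL_rat n\<^esub> A) = inverse (det A)"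
proof -
  interpret group "GL_rat n" by (rule group_GL_rat)
  have c: "A \<in> carrier_mat n n" "inv\<^bsub>GL_rat n\<^esub> A \<in> carrier_mat n n"
    using assms inv_closed[OF assms] unfolding GL_rat_simps by auto
  have "A * inv\<^bsub>GL_rat n\<^esub> A = 1\<^sub>m n" using r_inv[OF assms] unfolding GL_rat_simps .
  then have "det A * det (inv\<^bsub>GL_rat n\<^esub> A) = 1" using det_mult[OF c] by simp
  then show "det A \<noteq> 0" "det (inv\<^bsub>GL_rat n\<^esub> A) = inverse (det A)"
    by (auto simp: inverse_unique)
qed

lemma det_GL_rat_int_pow:
  assumes A: "A \<in> carrier (GL_rat n)"
  shows "det (A [^]\<^bsub>GL_rat n\<^esub> (k::int)) = det A powi k"
proof -
  interpret group "GL_rat n" by (rule group_GL_rat)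
  have nat: "det (B [^]\<^bsub>GL_rat n\<^esub> (m::nat)) = det B ^ m" if B: "B \<in> carrier (GL_rat n)" for B m
  proof (induction m)
    case 0 then show ?case by (simp add: GL_rat_simps)
  next
    case (Suc m)
    have "B [^]\<^bsub>GL_rat n\<^esub> m \<in> carrier_mat n n" "B \<in> carrier_mat n n"
      using nat_pow_closed[OF B, of m] B unfolding GL_rat_simps by auto
    then show ?case using Suc by (simp add: GL_rat_simps(1) det_mult mult.commute)
  qed
  show ?thesis
  proof (cases "k < 0")
    case True
    then have "A [^]\<^bsub>GL_rat n\<^esub> k = inv\<^bsub>GL_rat n\<^esub> (A [^]\<^bsub>GL_rat n\<^esub> nat (- k))" by (simp add: int_pow_def2 del: pow_nat)
    then show ?thesis using True det_GL_rat_inv(2)[OF nat_pow_closed[OF A]] nat[OF A]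
      by (simp add: power_int_def power_inverse del: pow_nat)
  next
    case False
    then show ?thesis using nat[OF A] by (simp add: int_pow_def2 power_int_def del: pow_nat)
  qed
qed

lemma (in group) foldr_mult_closed:
  "set xs \<subseteq> carrier G \<Longrightarrow> foldr (\<otimes>) xs \<one> \<in> carrier G"
  by (induction xs) auto

lemma det_foldr_GL_rat:
  "set xs \<subseteq> carrier (GL_rat n) \<Longrightarrow>
   det (foldr (\<otimes>\<^bsub>GL_rat n\<^esub>) xs \<one>\<^bsub>GL_rat n\<^esub>) = (\<Prod>l<length xs. det (xs ! l))"
proof (induction xs)
  case Nil then show ?case by (simp add: GL_rat_simps)
next
  case (Cons x xs)
  interpret group "GL_rat n" by (rule group_GL_rat)
  have "x \<in> carrier_mat n n" "foldr (\<otimes>\<^bsub>GL_rat n\<^esub>) xs \<one>\<^bsub>GL_rat n\<^esub> \<in> carrier_mat n n"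
    using Cons.prems foldr_mult_closed[of xs] unfolding GL_rat_simps by auto
  then have "det (foldr (\<otimes>\<^bsub>GL_rat n\<^esub>) (x # xs) \<one>\<^bsub>GL_rat n\<^esub>)
      = det x * det (foldr (\<otimes>\<^bsub>GL_rat n\<^esub>) xs \<one>\<^bsub>GL_rat n\<^esub>)"
    by (simp add: GL_rat_simps(1) det_mult)
  then show ?case using Cons by (simp add: prod.lessThan_Suc_shift del: prod.lessThan_Suc)
qed

text \<open>Take exponent 1 at position \<open>l\<close> and 0 elsewhere.\<close>

lemma (in group) cyclic_prod_component:
  assumes "set As \<subseteq> carrier G" "l < length As"
  shows "As ! l \<in> cyclic_prod G As"
proof -
  have zero: "foldr (\<otimes>) (map2 (\<lambda>A k. A [^] k) As (replicate (length As) (0::int))) \<one> = \<one>"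
    if "set As \<subseteq> carrier G" for As
    using that by (induction As) auto
  have "\<exists>ks::int list. length ks = length As \<and> foldr (\<otimes>) (map2 (\<lambda>A k. A [^] k) As ks) \<one> = As ! l"
    using assms
  proof (induction As arbitrary: l)
    case (Cons A As)
    show ?case
    proof (cases l)
      case 0
      show ?thesis
        using Cons.prems zero[of As] 0 by (intro exI[of _ "1 # replicate (length As) 0"]) auto
    next
      case (Suc l')
      then obtain ks :: "int list" where ks: "length ks = length As"
        "foldr (\<otimes>) (map2 (\<lambda>A k. A [^] k) As ks) \<one> = As ! l'" using Cons.IH[of l'] Cons.prems by auto
      have "As ! l' \<in> carrier G" using Cons.prems Suc nth_mem[of l' As] by auto
      then show ?thesis using ks Suc Cons.prems by (intro exI[of _ "0 # ks"]) auto
    qed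
  qed simp
  then show ?thesis unfolding cyclic_prod_def by force
qed

section \<open>Matrices integral at a prime\<close>

text \<open>The entries lie in the localisation of the integers at \<open>p\<close>, expressed by a
  common denominator \<open>N\<close> prime to \<open>p\<close>.\<close>

definition p_integral :: "int \<Rightarrow> nat \<Rightarrow> rat mat \<Rightarrow> bool" where
  "p_integral p n X \<longleftrightarrow> X \<in> carrier_mat n n \<and>
     (\<exists>N Y. \<not> p dvd N \<and> Y \<in> carrier_mat n n \<and> rat_of_int N \<cdot>\<^sub>m X = rat_mat Y)"

lemma p_integral_rat_mat:
  assumes "prime p" "A \<in> carrier_mat n n" shows "p_integral p n (rat_mat A)"
  unfolding p_integral_def using assms not_prime_unit by (intro conjI exI[of _ 1] exI[of _ A]) auto

lemma p_integral_one: "prime p \<Longrightarrow> p_integral p n (1\<^sub>m n)"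
  using p_integral_rat_mat[of p "1\<^sub>m n" n] by (simp add: of_int_hom.mat_hom_one)

lemma smult_mat_smult_mat: "a \<cdot>\<^sub>m (b \<cdot>\<^sub>m X) = (a * b :: rat) \<cdot>\<^sub>m X"
  by (intro eq_matI) auto

lemma p_integral_mult:
  assumes p: "prime p" and X: "p_integral p n X" "p_integral p n X'"
  shows "p_integral p n (X * X')"
proof -
  obtain N Y where 1: "X \<in> carrier_mat n n" "\<not> p dvd N" "Y \<in> carrier_mat n n" "rat_of_int N \<cdot>\<^sub>m X = rat_mat Y"
    using X(1) unfolding p_integral_def by auto
  obtain N' Y' where 2: "X' \<in> carrier_mat n n" "\<not> p dvd N'" "Y' \<in> carrier_mat n n" "rat_of_int N' \<cdot>\<^sub>m X' = rat_mat Y'"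
    using X(2) unfolding p_integral_def by auto
  have "rat_of_int (N * N') \<cdot>\<^sub>m (X * X') = (rat_of_int N \<cdot>\<^sub>m X) * (rat_of_int N' \<cdot>\<^sub>m X')"
    using 1(1) 2(1)
    by (simp add: mult_smult_distrib[of _ n n _ n] mult_smult_assoc_mat[of _ n n _ n] smult_mat_smult_mat mult.commute)
  also have "\<dots> = rat_mat (Y * Y')" unfolding 1(4) 2(4) using 1(3) 2(3) by (simp add: of_int_hom.mat_hom_mult)
  finally have "rat_of_int (N * N') \<cdot>\<^sub>m (X * X') = rat_mat (Y * Y')" .
  moreover have "\<not> p dvd N * N'" using p 1 2 by (simp add: prime_dvd_mult_iff)
  ultimately show ?thesis unfolding p_integral_def using 1 2
    by (intro conjI exI[of _ "N * N'"] exI[of _ "Y * Y'"]) auto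
qed

text \<open>By Cramer's rule \<open>det A\<close> is a denominator of the inverse, with numerator
  \<open>adj_mat A\<close>.\<close>

lemma p_integral_inverse:
  assumes A: "A \<in> carrier_mat n n" "\<not> p dvd det A" and X: "X \<in> carrier_mat n n" "rat_mat A * X = 1\<^sub>m n"
  shows "p_integral p n X"
proof -
  have adj: "adj_mat A \<in> carrier_mat n n" "adj_mat A * A = det A \<cdot>\<^sub>m 1\<^sub>m n" using adj_mat[OF A(1)] by auto
  have "rat_mat (adj_mat A) = rat_mat (adj_mat A) * (rat_mat A * X)" using X adj by simp
  also have "\<dots> = rat_mat (adj_mat A * A) * X"
    unfolding of_int_hom.mat_hom_mult[OF adj(1) A(1)]
    by (rule assoc_mult_mat[symmetric, of _ n n _ n _ n]) (use X A adj in auto)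
  also have "\<dots> = (rat_of_int (det A) \<cdot>\<^sub>m 1\<^sub>m n) * X"
    unfolding adj(2) by (rule arg_cong[of _ _ "\<lambda>Y. Y * X"]) (intro eq_matI, auto)
  also have "\<dots> = rat_of_int (det A) \<cdot>\<^sub>m X" using X by (simp add: mult_smult_assoc_mat[of _ n n _ n])
  finally show ?thesis unfolding p_integral_def using A X adj by (intro conjI exI[of _ "det A"] exI[of _ "adj_mat A"]) auto
qed

lemma p_integral_int_pow:
  assumes p: "prime p" and A: "A \<in> carrier_mat n n" "rat_mat A \<in> carrier (GL_rat n)" "\<not> p dvd det A"
  shows "p_integral p n (rat_mat A [^]\<^bsub>GL_rat n\<^esub> (k::int))"
proof -
  interpret group "GL_rat n" by (rule group_GL_rat)
  have nat: "p_integral p n (B [^]\<^bsub>GL_rat n\<^esub> (m::nat))" if B: "p_integral p n B" for B m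
    by (induction m) (use p_integral_one[OF p] p_integral_mult[OF p _ B] in \<open>auto simp: GL_rat_simps\<close>)
  have inv: "p_integral p n (inv\<^bsub>GL_rat n\<^esub> (rat_mat A))"
    using r_inv[OF A(2)] inv_closed[OF A(2)] A by (intro p_integral_inverse[of A]) (auto simp: GL_rat_simps)
  show ?thesis
  proof (cases "k < 0")
    case True
    then have "rat_mat A [^]\<^bsub>GL_rat n\<^esub> k = (inv\<^bsub>GL_rat n\<^esub> (rat_mat A)) [^]\<^bsub>GL_rat n\<^esub> nat (- k)"
      using A(2) by (simp add: int_pow_def2 nat_pow_inv del: pow_nat)
    then show ?thesis using nat[OF inv] by (simp del: pow_nat)
  next
    case False
    then show ?thesis using nat[OF p_integral_rat_mat[OF p A(1)]] by (simp add: int_pow_def2 del: pow_nat)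
  qed
qed

lemma p_integral_foldr:
  assumes "prime p" "\<And>x. x \<in> set xs \<Longrightarrow> p_integral p n x"
  shows "p_integral p n (foldr (\<otimes>\<^bsub>GL_rat n\<^esub>) xs \<one>\<^bsub>GL_rat n\<^esub>)"
  using assms(2)
  by (induction xs) (auto simp: GL_rat_simps p_integral_one[OF assms(1)] intro: p_integral_mult[OF assms(1)])

lemma rat_mat_in_GL_rat:
  assumes "A \<in> carrier_mat n n" "det A \<noteq> 0"
  shows "rat_mat A \<in> carrier (GL_rat n)"
proof -
  have c: "rat_mat A \<in> carrier_mat n n" using assms by simp
  have "det (rat_mat A) \<noteq> 0" using assms by simp
  then obtain B where "B \<in> carrier_mat n n" "B * rat_mat A = 1\<^sub>m n" "rat_mat A * B = 1\<^sub>m n"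
    using det_non_zero_imp_unit[OF c, of "()"] unfolding Units_def by (auto simp: ring_mat_def)
  then show ?thesis using c unfolding GL_rat_simps by auto
qed

text \<open>Being in the subgroup, the commutator \<open>C\<close> is itself a product of powers of
  the given matrices. Its determinant 1 turns the exponents into a multiplicative relation, and its
  denominators come only from matrices with nonzero exponent.\<close>

lemma group_tuples_commutator:
  assumes As: "As \<in> group_tuples n s H" and ij: "i < s" "j < s"
  obtains k C where "mult_relation s (\<lambda>l. det (As ! l)) k" "C \<in> carrier_mat n n"
    "C * (rat_mat (As ! i) * rat_mat (As ! j)) = rat_mat (As ! j) * rat_mat (As ! i)"
    "\<And>p. prime p \<Longrightarrow> (\<And>l. l < s \<Longrightarrow> k l \<noteq> 0 \<Longrightarrow> \<not> p dvd det (As ! l)) \<Longrightarrow> p_integral p n C"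
proof -
  interpret group "GL_rat n" by (rule group_GL_rat)
  define Ms where "Ms = map rat_mat As"
  have len: "length As = s" "length Ms = s" using As unfolding group_tuples_def Ms_def by auto
  have sub: "subgroup (cyclic_prod (GL_rat n) Ms) (GL_rat n)" using As unfolding group_tuples_def Ms_def by auto
  have A: "As ! l \<in> carrier_mat n n" "det (As ! l) \<noteq> 0" if "l < s" for l
    using As nth_mem[of l As] that len unfolding group_tuples_def int_mats_def by auto
  have Ms: "Ms ! l = rat_mat (As ! l)" if "l < s" for l using that len unfolding Ms_def by simp
  have M: "Ms ! l \<in> carrier (GL_rat n)" if "l < s" for l
    using rat_mat_in_GL_rat[OF A[OF that]] that Ms by simp
  then have Mset: "set Ms \<subseteq> carrier (GL_rat n)" using len by (auto simp: in_set_conv_nth)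
  define P where "P = cyclic_prod (GL_rat n) Ms"
  have MP: "Ms ! l \<in> P" if "l < s" for l using cyclic_prod_component[OF Mset] that len unfolding P_def by simp
  \<comment> \<open>Equal to \<open>A_j A_i A_j^(-1) A_i^(-1)\<close>, written with a single inverse
    so that \<open>C * (A_i * A_j) = A_j * A_i\<close> is immediate.\<close>
  define C where "C = (Ms ! j \<otimes>\<^bsub>GL_rat n\<^esub> Ms ! i) \<otimes>\<^bsub>GL_rat n\<^esub> inv\<^bsub>GL_rat n\<^esub> (Ms ! i \<otimes>\<^bsub>GL_rat n\<^esub> Ms ! j)"
  have "C \<in> P" unfolding C_def using sub MP ij unfolding P_def[symmetric]
    by (intro subgroup.m_closed[OF sub[folded P_def]] subgroup.m_inv_closed[OF sub[folded P_def]]) auto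
  then obtain ks :: "int list" where ks: "length ks = s"
    "C = foldr (\<otimes>\<^bsub>GL_rat n\<^esub>) (map2 (\<lambda>A k. A [^]\<^bsub>GL_rat n\<^esub> k) Ms ks) \<one>\<^bsub>GL_rat n\<^esub>"
    unfolding P_def cyclic_prod_def using len by auto
  define xs where "xs = map2 (\<lambda>A k. A [^]\<^bsub>GL_rat n\<^esub> k) Ms ks"
  have xs: "length xs = s" "\<And>l. l < s \<Longrightarrow> xs ! l = Ms ! l [^]\<^bsub>GL_rat n\<^esub> (ks ! l)"
    unfolding xs_def using len ks(1) by auto
  have xset: "set xs \<subseteq> carrier (GL_rat n)" using xs M by (auto simp: in_set_conv_nth)
  have cij: "Ms ! i \<in> carrier (GL_rat n)" "Ms ! j \<in> carrier (GL_rat n)" using M ij by auto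
  have CC: "C \<in> carrier (GL_rat n)" unfolding C_def using cij by simp
  have Ceq: "C \<otimes>\<^bsub>GL_rat n\<^esub> (Ms ! i \<otimes>\<^bsub>GL_rat n\<^esub> Ms ! j) = Ms ! j \<otimes>\<^bsub>GL_rat n\<^esub> Ms ! i"
    unfolding C_def using cij by (simp add: m_assoc)
  have Cc: "C \<in> carrier_mat n n" using CC unfolding GL_rat_simps by auto
  have mc: "Ms ! i \<in> carrier_mat n n" "Ms ! j \<in> carrier_mat n n" using cij unfolding GL_rat_simps by auto
  show ?thesis
  proof (rule that[of "\<lambda>l. ks ! l" C])
    show "C \<in> carrier_mat n n" by fact
    show "C * (rat_mat (As ! i) * rat_mat (As ! j)) = rat_mat (As ! j) * rat_mat (As ! i)"
      using Ceq Ms ij unfolding GL_rat_simps by simp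
    have "det C * (det (Ms ! i) * det (Ms ! j)) = det (Ms ! j) * det (Ms ! i)"
    proof -
      have "det (Ms ! j * Ms ! i) = det (C * (Ms ! i * Ms ! j))" using Ceq unfolding GL_rat_simps by simp
      also have "\<dots> = det C * (det (Ms ! i) * det (Ms ! j))"
        using mc Cc by (simp add: det_mult[of _ n])
      finally show ?thesis using mc by (auto simp: det_mult[of _ n])
    qed
    then have "det C = 1" using det_GL_rat_inv(1)[OF cij(1)] det_GL_rat_inv(1)[OF cij(2)] by simp
    moreover have "det C = (\<Prod>l<s. rat_of_int (det (As ! l)) powi (ks ! l))"
      unfolding ks(2) xs_def[symmetric] det_foldr_GL_rat[OF xset] xs(1)
      using xs M Ms by (intro prod.cong) (auto simp: det_GL_rat_int_pow)
    ultimately show "mult_relation s (\<lambda>l. det (As ! l)) (\<lambda>l. ks ! l)" unfolding mult_relation_def by simp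
    fix p :: int assume p: "prime p" and np: "\<And>l. l < s \<Longrightarrow> ks ! l \<noteq> 0 \<Longrightarrow> \<not> p dvd det (As ! l)"
    show "p_integral p n C"
      unfolding ks(2) xs_def[symmetric]
    proof (rule p_integral_foldr[OF p])
      fix x assume "x \<in> set xs"
      then obtain l where l: "l < s" "x = Ms ! l [^]\<^bsub>GL_rat n\<^esub> (ks ! l)" using xs by (auto simp: in_set_conv_nth)
      show "p_integral p n x"
      \<comment> \<open>Exponent 0 gives the identity, integral at every prime; for the other
        positions \<open>p\<close> does not divide the determinant.\<close>
      proof (cases "ks ! l = 0")
        case True
        then show ?thesis using l(2) p_integral_one[OF p] by (simp add: GL_rat_simps)
      next
        case False
        then show ?thesis
          unfolding l(2) Ms[OF l(1)] using A[OF l(1)] l(1) np rat_mat_in_GL_rat[OF A[OF l(1)]]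
          by (intro p_integral_int_pow p) auto
      qed
    qed
  qed
qed

section \<open>Counting tuples\<close>

text \<open>The positions in \<open>R\<close> are free in \<open>\<Omega>\<close>. They determine
  the set \<open>\<Phi> As\<close>, to which all other entries are confined.\<close>

lemma card_tuples_le:
  fixes m w :: real and \<Omega> :: "'a set"
  assumes fin: "finite \<Omega>" and w: "real (card \<Omega>) \<le> w" and m: "m \<ge> 0" and R: "R \<subseteq> {..<s}"
    and T: "\<And>As. As \<in> \<T> \<Longrightarrow> length As = s \<and> set As \<subseteq> \<Omega>"
    and dep: "\<And>As As'. As \<in> \<T> \<Longrightarrow> As' \<in> \<T> \<Longrightarrow> (\<And>l. l \<in> R \<Longrightarrow> As ! l = As' ! l) \<Longrightarrow> \<Phi> As = \<Phi> As'"
    and mem: "\<And>As l. As \<in> \<T> \<Longrightarrow> l < s \<Longrightarrow> l \<notin> R \<Longrightarrow> As ! l \<in> \<Phi> As"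
    and card: "\<And>As. As \<in> \<T> \<Longrightarrow> \<Phi> As \<subseteq> \<Omega> \<and> real (card (\<Phi> As)) \<le> m"
  shows "finite \<T>" "real (card \<T>) \<le> w ^ card R * m ^ (s - card R)"
proof -
  have "\<T> \<subseteq> {xs. set xs \<subseteq> \<Omega> \<and> length xs = s}" using T by auto
  then show finT: "finite \<T>" using finite_lists_length_eq[OF fin] finite_subset by blast
  have finR: "finite R" using R finite_subset by blast
  define f where "f = (\<lambda>As :: 'a list. restrict (\<lambda>l. As ! l) R)"
  have f: "f As' = f As \<longleftrightarrow> (\<forall>l\<in>R. As' ! l = As ! l)" for As As'
    unfolding f_def restrict_def by (auto simp: fun_eq_iff)
  have "real (card \<T>) \<le> real (card (R \<rightarrow>\<^sub>E \<Omega>)) * m ^ (s - card R)"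
  proof (rule card_le_fibres[where f = f])
    show "f ` \<T> \<subseteq> R \<rightarrow>\<^sub>E \<Omega>"
    proof clarify
      fix As assume As: "As \<in> \<T>"
      have "As ! l \<in> \<Omega>" if "l \<in> R" for l
      proof -
        have "l < length As" using that R T[OF As] by auto
        then show ?thesis using T[OF As] nth_mem by blast
      qed
      then show "f As \<in> R \<rightarrow>\<^sub>E \<Omega>" unfolding f_def by auto
    qed
    fix As assume As: "As \<in> \<T>"
    \<comment> \<open>On a fibre of \<open>f\<close> the set \<open>\<Phi> As\<close> is constant,
      and a tuple is determined by its \<open>s - card R\<close> entries outside
      \<open>R\<close>.\<close>
    define g where "g = (\<lambda>As :: 'a list. restrict (\<lambda>l. As ! l) ({..<s} - R))"
    define F where "F = {As' \<in> \<T>. f As' = f As}"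
    have finP: "finite (\<Phi> As)" using card[OF As] fin finite_subset by blast
    have "inj_on g F"
    proof (rule inj_onI)
      fix x y assume x: "x \<in> F" and y: "y \<in> F" and eq: "g x = g y"
      show "x = y"
      proof (rule nth_equalityI)
        show "length x = length y" using x y T unfolding F_def by auto
        fix l assume "l < length x"
        then have l: "l < s" using x T unfolding F_def by auto
        show "x ! l = y ! l"
        proof (cases "l \<in> R")
          case True then show ?thesis using x y f unfolding F_def by auto
        next
          case False
          then show ?thesis using fun_cong[OF eq, of l] l unfolding g_def by simp
        qed
      qed
    qed
    moreover have "g ` F \<subseteq> ({..<s} - R) \<rightarrow>\<^sub>E \<Phi> As"
    proof clarify
      fix x assume x: "x \<in> F"
      have "\<Phi> x = \<Phi> As" using x As f unfolding F_def by (intro dep) auto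
      then have "x ! l \<in> \<Phi> As" if "l < s" "l \<notin> R" for l using mem[of x l] x that unfolding F_def by auto
      then show "g x \<in> ({..<s} - R) \<rightarrow>\<^sub>E \<Phi> As" unfolding g_def by auto
    qed
    ultimately have "card F \<le> card (({..<s} - R) \<rightarrow>\<^sub>E \<Phi> As)"
      using finP by (intro card_inj_on_le finite_PiE) auto
    also have "\<dots> = card (\<Phi> As) ^ (s - card R)"
      using R finR by (simp add: card_PiE card_Diff_subset)
    finally have "real (card F) \<le> real (card (\<Phi> As)) ^ (s - card R)"
      by (simp only: of_nat_power[symmetric] of_nat_le_iff)
    also have "\<dots> \<le> m ^ (s - card R)" using card[OF As] by (intro power_mono) auto
    finally show "real (card {As' \<in> \<T>. f As' = f As}) \<le> m ^ (s - card R)" unfolding F_def .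
  qed (use finT fin finR m in \<open>auto intro: finite_PiE\<close>)
  also have "real (card (R \<rightarrow>\<^sub>E \<Omega>)) = real (card \<Omega>) ^ card R" using finR by (simp add: card_PiE)
  also have "\<dots> * m ^ (s - card R) \<le> w ^ card R * m ^ (s - card R)"
    using w m by (intro mult_right_mono power_mono) auto
  finally show "real (card \<T>) \<le> w ^ card R * m ^ (s - card R)" .
qed

text \<open>Each of the \<open>r\<close> free matrices costs \<open>n^2\<close> in the exponent and
  each other one \<open>n^2 - n + e\<close>, so the saving is \<open>(s - r) * n\<close>.\<close>

lemma pattern_exponent_le:
  fixes C H e :: real
  assumes H: "H \<ge> 1" and C: "C \<ge> 1" and r: "r \<le> s" "2 * r \<le> s + 1" and n: "n \<ge> 1" and s: "s \<ge> 1" and e: "e \<ge> 0"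
  shows "((3 * H) ^ (n ^ 2)) ^ r * (C * H powr (real (n * (n - 1)) + e)) ^ (s - r)
    \<le> (3 ^ (n ^ 2) * C) ^ s * H powr (real s * real n ^ 2 - (real s - 1) * real n / 3 + real s * e)"
proof -
  have H0: "H > 0" using H by simp
  have nn: "real (n * (n - 1)) = real n ^ 2 - real n" using n by (simp add: of_nat_diff power2_eq_square algebra_simps)
  have "((3 * H) ^ (n ^ 2)) ^ r * (C * H powr (real (n * (n - 1)) + e)) ^ (s - r)
      = ((3 ^ (n ^ 2)) ^ r * C ^ (s - r)) * ((H ^ (n ^ 2)) ^ r * (H powr (real (n * (n - 1)) + e)) ^ (s - r))"
    by (simp add: power_mult_distrib mult_ac)
  also have "(H ^ (n ^ 2)) ^ r * (H powr (real (n * (n - 1)) + e)) ^ (s - r)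
      = H powr (real n ^ 2 * real r + (real (n * (n - 1)) + e) * real (s - r))"
  proof -
    have "(H powr x) ^ k = H powr (x * real k)" for x k
      using H0 by (simp add: powr_powr powr_realpow[symmetric])
    moreover have "(H ^ (n ^ 2)) ^ r = H powr (real n ^ 2 * real r)"
      using H0 by (simp add: powr_powr powr_realpow[symmetric])
    ultimately show ?thesis by (simp only: powr_add[of H "real n ^ 2 * real r"])
  qed
  also have "((3 ^ (n ^ 2)) ^ r * C ^ (s - r)) * H powr (real n ^ 2 * real r + (real (n * (n - 1)) + e) * real (s - r))
    \<le> ((3 ^ (n ^ 2)) ^ s * C ^ s) * H powr (real s * real n ^ 2 - (real s - 1) * real n / 3 + real s * e)"
  proof (intro mult_mono powr_mono power_increasing)
    show "(1::real) \<le> 3 ^ n\<^sup>2" by (rule one_le_power) simp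
    \<comment> \<open>At least half of \<open>s - 1\<close> positions are constrained, which more
      than covers the third that is claimed.\<close>
    have sr: "real (s - r) \<ge> (real s - 1) / 2" using r by (simp add: of_nat_diff)
    have "(real s - 1) / 3 \<le> real (s - r)" using sr s by simp
    then have 1: "(real s - 1) * real n / 3 \<le> real (s - r) * real n"
      using mult_right_mono[of "(real s - 1) / 3" "real (s - r)" "real n"] by simp
    have 2: "e * real (s - r) \<le> real s * e"
      using mult_left_mono[of "real (s - r)" "real s" e] e by (simp add: mult.commute)
    have "real n ^ 2 * real r + (real n ^ 2 - real n + e) * real (s - r)
        = real n ^ 2 * (real r + real (s - r)) - real (s - r) * real n + e * real (s - r)"
      by (simp add: algebra_simps)
    also have "real r + real (s - r) = real s" using r by (simp add: of_nat_diff)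
    finally show "real n ^ 2 * real r + (real (n * (n - 1)) + e) * real (s - r)
       \<le> real s * real n ^ 2 - (real s - 1) * real n / 3 + real s * e"
      unfolding nn using 1 2 by (simp add: mult.commute[of "real n ^ 2" "real s"])
  qed (use C H r in \<open>auto intro!: mult_nonneg_nonneg\<close>)
  finally show ?thesis by (simp add: power_mult_distrib)
qed

section \<open>Three families of tuples and their sizes\<close>

definition det_supported :: "nat \<Rightarrow> real \<Rightarrow> int \<Rightarrow> int mat set" where
  "det_supported n H K = {A \<in> int_mats n H. det A \<noteq> 0 \<and> (\<forall>p. prime p \<longrightarrow> p dvd det A \<longrightarrow> p dvd K)}"

text \<open>A constant \<open>E\<close> is independent of every row, so the general count applies
  with \<open>q = 0\<close>.\<close>

lemma card_det_supported_le:
  fixes a e :: real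
  assumes e: "e > 0" and n: "n \<ge> 1" and a: "a \<ge> 0"
  shows "\<exists>C\<ge>0. \<forall>H\<ge>1. \<forall>K. K \<noteq> 0 \<longrightarrow> \<bar>real_of_int K\<bar> \<le> a * H ^ b \<longrightarrow>
    real (card (det_supported n H K)) \<le> C * H powr (real (n * (n - 1)) + e)"
proof -
  obtain C where C: "C \<ge> 0" "\<And>H q E. H \<ge> 1 \<Longrightarrow> q < n \<Longrightarrow>
    (\<forall>A\<in>int_mats n H. \<forall>A'\<in>int_mats n H. agree_off n q A A' \<longrightarrow> E A = E A') \<Longrightarrow>
    real (card {A \<in> int_mats n H. det A \<noteq> 0 \<and> E A \<noteq> 0 \<and> \<bar>real_of_int (E A)\<bar> \<le> a * H ^ b \<and>
       (\<forall>p. prime p \<longrightarrow> p dvd det A \<longrightarrow> p dvd E A)}) \<le> C * H powr (real (n * (n - 1)) + e)"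
    using card_mats_det_supported_le[OF e n a, of b] by blast
  have "real (card (det_supported n H K)) \<le> C * H powr (real (n * (n - 1)) + e)"
    if "H \<ge> 1" "K \<noteq> 0" "\<bar>real_of_int K\<bar> \<le> a * H ^ b" for H K
    using C(2)[of H 0 "\<lambda>_. K"] n that unfolding det_supported_def by simp
  then show ?thesis using C(1) by blast
qed

definition base_tuples :: "nat \<Rightarrow> nat \<Rightarrow> real \<Rightarrow> int mat list set" where
  "base_tuples n s H = {As. length As = s \<and> (\<forall>A \<in> set As. A \<in> int_mats n H \<and> det A \<noteq> 0)}"

text \<open>The integer K of the opening overview, as a function of the tuple; it depends only on
  the entries at \<open>T\<close>.\<close>

definition det_prod :: "nat set \<Rightarrow> int mat list \<Rightarrow> int" where
  "det_prod T As = (\<Prod>l\<in>T. det (As ! l))"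

lemma det_prod_bounds:
  assumes As: "As \<in> base_tuples n s H" and T: "T \<subseteq> {..<s}" and H: "H \<ge> 1"
  shows "det_prod T As \<noteq> 0" "\<bar>real_of_int (det_prod T As)\<bar> \<le> fact n ^ s * H ^ (n * s)"
proof -
  have A: "As ! l \<in> int_mats n H \<and> det (As ! l) \<noteq> 0" if "l \<in> T" for l
  proof -
    have "l < length As" using that T As unfolding base_tuples_def by auto
    then have "As ! l \<in> set As" by (rule nth_mem)
    then show ?thesis using As unfolding base_tuples_def by blast
  qed
  have finT: "finite T" using T finite_subset by blast
  then show "det_prod T As \<noteq> 0" using A unfolding det_prod_def by simp
  have f1: "fact n * H ^ n \<ge> 1"
    using H mult_mono[of 1 "fact n :: real" 1 "H ^ n"] by (simp add: fact_ge_1)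
  have "\<bar>real_of_int (det_prod T As)\<bar> = (\<Prod>l\<in>T. \<bar>real_of_int (det (As ! l))\<bar>)"
    unfolding det_prod_def by (simp add: abs_prod)
  also have "\<dots> \<le> (\<Prod>l\<in>T. fact n * H ^ n)"
    using A abs_det_int_mats_le by (intro prod_mono) auto
  also have "\<dots> = (fact n * H ^ n) ^ card T" by simp
  also have "\<dots> \<le> (fact n * H ^ n) ^ s"
    using f1 T card_mono[of "{..<s}" T] by (intro power_increasing) auto
  finally show "\<bar>real_of_int (det_prod T As)\<bar> \<le> fact n ^ s * H ^ (n * s)"
    by (simp add: power_mult_distrib power_mult)
qed

text \<open>Here the maximal relation involves all positions, so the primes of every determinant
  divide that of the part \<open>T\<close>.\<close>

definition full_support_tuples :: "nat \<Rightarrow> nat \<Rightarrow> real \<Rightarrow> nat set \<Rightarrow> int mat list set" where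
  "full_support_tuples n s H T = {As \<in> base_tuples n s H.
     \<forall>l<s. l \<notin> T \<longrightarrow> As ! l \<in> det_supported n H (det_prod T As)}"

text \<open>Here some position is outside the maximal relation, and \<open>As ! i\<close> is a
  non-scalar matrix with which commutators are formed.\<close>

definition partial_support_tuples :: "nat \<Rightarrow> nat \<Rightarrow> real \<Rightarrow> nat set \<Rightarrow> nat \<Rightarrow> int mat list set" where
  "partial_support_tuples n s H T i = {As \<in> base_tuples n s H. (\<forall>c. As ! i \<noteq> c \<cdot>\<^sub>m 1\<^sub>m n) \<and>
     (\<forall>l<s. l \<notin> insert i T \<longrightarrow> As ! l \<in> conj_supported n H (det_prod T As) (As ! i))}"

text \<open>Commutators with scalar matrices are trivial and constrain nothing, so tuples of scalar
  matrices are counted directly.\<close>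

definition scalar_tuples :: "nat \<Rightarrow> nat \<Rightarrow> real \<Rightarrow> int mat list set" where
  "scalar_tuples n s H = {As \<in> base_tuples n s H. \<forall>i<s. \<exists>c. As ! i = c \<cdot>\<^sub>m 1\<^sub>m n}"

text \<open>The free positions are those in \<open>T\<close>, at most half of all.\<close>

lemma card_full_support_tuples_le:
  fixes e :: real
  assumes e: "e > 0" and n: "n \<ge> 1" and s: "s \<ge> 1"
  shows "\<exists>C\<ge>0. \<forall>H\<ge>1. \<forall>T\<subseteq>{..<s}. 2 * card T \<le> s \<longrightarrow>
    real (card (full_support_tuples n s H T)) \<le> C * H powr (real s * real n ^ 2 - (real s - 1) * real n / 3 + real s * e)"
proof -
  have "(0::real) \<le> fact n ^ s" by simp
  from card_det_supported_le[OF e n this, of "n * s"]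
  obtain C where C: "C \<ge> 0" "\<And>H K. H \<ge> 1 \<Longrightarrow> K \<noteq> 0 \<Longrightarrow> \<bar>real_of_int K\<bar> \<le> fact n ^ s * H ^ (n * s) \<Longrightarrow>
    real (card (det_supported n H K)) \<le> C * H powr (real (n * (n - 1)) + e)" by blast
  \<comment> \<open>\<open>1 + C\<close> replaces \<open>C\<close> because
    \<open>pattern_exponent_le\<close> asks for a constant of at least 1.\<close>
  have "real (card (full_support_tuples n s H T)) \<le> (3 ^ (n ^ 2) * (1 + C)) ^ s *
      H powr (real s * real n ^ 2 - (real s - 1) * real n / 3 + real s * e)"
    if H: "H \<ge> 1" and T: "T \<subseteq> {..<s}" "2 * card T \<le> s" for H T
  proof -
    have "real (card (full_support_tuples n s H T)) \<le>
        ((3 * H) ^ (n ^ 2)) ^ card T * ((1 + C) * H powr (real (n * (n - 1)) + e)) ^ (s - card T)"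
    proof (rule card_tuples_le(2)[where \<Omega> = "int_mats n H" and \<Phi> = "\<lambda>As. det_supported n H (det_prod T As)"])
      fix As assume As: "As \<in> full_support_tuples n s H T"
      then have b: "As \<in> base_tuples n s H" unfolding full_support_tuples_def by auto
      then show "length As = s \<and> set As \<subseteq> int_mats n H" unfolding base_tuples_def by auto
      have "real (card (det_supported n H (det_prod T As))) \<le> C * H powr (real (n * (n - 1)) + e)"
        by (intro C(2) H det_prod_bounds[OF b T(1) H])
      also have "\<dots> \<le> (1 + C) * H powr (real (n * (n - 1)) + e)" by (intro mult_right_mono) auto
      finally show "det_supported n H (det_prod T As) \<subseteq> int_mats n H \<and>
          real (card (det_supported n H (det_prod T As))) \<le> (1 + C) * H powr (real (n * (n - 1)) + e)"
        unfolding det_supported_def by auto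
    next
      fix As As' :: "int mat list" assume "\<And>l. l \<in> T \<Longrightarrow> As ! l = As' ! l"
      then show "det_supported n H (det_prod T As) = det_supported n H (det_prod T As')"
        unfolding det_prod_def by simp
    qed (use H T C(1) card_int_mats[OF H] in \<open>auto simp: full_support_tuples_def\<close>)
    also have "\<dots> \<le> (3 ^ (n ^ 2) * (1 + C)) ^ s * H powr (real s * real n ^ 2 - (real s - 1) * real n / 3 + real s * e)"
      using H C(1) T n s e by (intro pattern_exponent_le) auto
    finally show ?thesis .
  qed
  then show ?thesis using C(1) by (intro exI[of _ "(3 ^ (n ^ 2) * (1 + C)) ^ s"]) auto
qed

lemma card_partial_support_tuples_le:
  fixes e :: real
  assumes e: "e > 0" and n: "n \<ge> 1" and s: "s \<ge> 1"
  shows "\<exists>C\<ge>0. \<forall>H\<ge>1. \<forall>T\<subseteq>{..<s}. \<forall>i<s. 2 * card T + 1 \<le> s \<longrightarrow>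
    real (card (partial_support_tuples n s H T i)) \<le> C * H powr (real s * real n ^ 2 - (real s - 1) * real n / 3 + real s * e)"
proof -
  have "(0::real) \<le> fact n ^ s" by simp
  from card_conj_supported_le[OF e n this, of "n * s"]
  obtain C where C: "C \<ge> 0" "\<And>H B K. H \<ge> 1 \<Longrightarrow> B \<in> int_mats n H \<Longrightarrow> (\<forall>c. B \<noteq> c \<cdot>\<^sub>m 1\<^sub>m n) \<Longrightarrow>
    K \<noteq> 0 \<Longrightarrow> \<bar>real_of_int K\<bar> \<le> fact n ^ s * H ^ (n * s) \<Longrightarrow>
    real (card (conj_supported n H K B)) \<le> C * H powr (real (n * (n - 1)) + e)" by blast
  have "real (card (partial_support_tuples n s H T i)) \<le> (3 ^ (n ^ 2) * (1 + C)) ^ s *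
      H powr (real s * real n ^ 2 - (real s - 1) * real n / 3 + real s * e)"
    if H: "H \<ge> 1" and T: "T \<subseteq> {..<s}" "2 * card T + 1 \<le> s" and i: "i < s" for H T i
  proof -
    have finT: "finite T" using T(1) finite_subset by blast
    \<comment> \<open>The free positions are \<open>T\<close> and \<open>i\<close>. The strict
      inequality \<open>2 * card T < s\<close> pays for the extra one:
      \<open>2 * (card T + 1) \<le> s + 1\<close>.\<close>
    have cR: "2 * card (insert i T) \<le> s + 1" using T(2) finT by (simp add: card_insert_if)
    have R: "insert i T \<subseteq> {..<s}" using T i by auto
    have "real (card (partial_support_tuples n s H T i)) \<le>
        ((3 * H) ^ (n ^ 2)) ^ card (insert i T) * ((1 + C) * H powr (real (n * (n - 1)) + e)) ^ (s - card (insert i T))"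
    proof (rule card_tuples_le(2)[where \<Omega> = "int_mats n H" and \<Phi> = "\<lambda>As. conj_supported n H (det_prod T As) (As ! i)"])
      fix As assume As: "As \<in> partial_support_tuples n s H T i"
      then have b: "As \<in> base_tuples n s H" unfolding partial_support_tuples_def by auto
      then show l: "length As = s \<and> set As \<subseteq> int_mats n H" unfolding base_tuples_def by auto
      have "As ! i \<in> int_mats n H" using l i nth_mem[of i As] by auto
      then have "real (card (conj_supported n H (det_prod T As) (As ! i))) \<le> C * H powr (real (n * (n - 1)) + e)"
        using As by (intro C(2) H det_prod_bounds[OF b T(1) H]) (auto simp: partial_support_tuples_def)
      also have "\<dots> \<le> (1 + C) * H powr (real (n * (n - 1)) + e)" by (intro mult_right_mono) auto
      finally show "conj_supported n H (det_prod T As) (As ! i) \<subseteq> int_mats n H \<and>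
          real (card (conj_supported n H (det_prod T As) (As ! i))) \<le> (1 + C) * H powr (real (n * (n - 1)) + e)"
        unfolding conj_supported_def by auto
    next
      fix As As' :: "int mat list" assume "\<And>l. l \<in> insert i T \<Longrightarrow> As ! l = As' ! l"
      then show "conj_supported n H (det_prod T As) (As ! i) = conj_supported n H (det_prod T As') (As' ! i)"
        unfolding det_prod_def by simp
    qed (use H R C(1) card_int_mats[OF H] in \<open>auto simp: partial_support_tuples_def\<close>)
    also have "\<dots> \<le> (3 ^ (n ^ 2) * (1 + C)) ^ s * H powr (real s * real n ^ 2 - (real s - 1) * real n / 3 + real s * e)"
      using H C(1) cR R n s e card_mono[OF _ R] by (intro pattern_exponent_le) auto
    finally show ?thesis .
  qed
  then show ?thesis using C(1) by (intro exI[of _ "(3 ^ (n ^ 2) * (1 + C)) ^ s"]) auto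
qed

text \<open>A scalar matrix has a single parameter, which leaves about \<open>H ^ s\<close> tuples,
  and \<open>s \<le> s * (n^2 - n / 3)\<close>.\<close>

lemma card_scalar_tuples_le:
  assumes n: "n \<ge> 2" and H: "H \<ge> 1" and e: "e \<ge> 0" and s: "s \<ge> 1"
  shows "real (card (scalar_tuples n s H)) \<le> 3 ^ s * H powr (real s * real n ^ 2 - (real s - 1) * real n / 3 + real s * e)"
proof -
  define Sc where "Sc = (\<lambda>c::int. c \<cdot>\<^sub>m 1\<^sub>m n) ` {c. \<bar>real_of_int c\<bar> \<le> H}"
  have I: "finite {c::int. \<bar>real_of_int c\<bar> \<le> H}" "real (card {c::int. \<bar>real_of_int c\<bar> \<le> H}) \<le> 3 * H"
    using card_int_interval[of H] H by auto
  have Sc: "finite Sc" "real (card Sc) \<le> 3 * H"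
    using I card_image_le[OF I(1), of "\<lambda>c::int. c \<cdot>\<^sub>m 1\<^sub>m n"] unfolding Sc_def by auto
  have "scalar_tuples n s H \<subseteq> {xs. set xs \<subseteq> Sc \<and> length xs = s}"
  proof clarify
    fix As assume As: "As \<in> scalar_tuples n s H"
    then have len: "length As = s" and A: "\<And>A. A \<in> set As \<Longrightarrow> A \<in> int_mats n H"
      unfolding scalar_tuples_def base_tuples_def by auto
    have "A \<in> Sc" if "A \<in> set As" for A
    proof -
      obtain i where "i < s" "A = As ! i" using \<open>A \<in> set As\<close> len by (auto simp: in_set_conv_nth)
      then obtain c where c: "A = c \<cdot>\<^sub>m 1\<^sub>m n" using As unfolding scalar_tuples_def by auto
      have "\<bar>real_of_int (A $$ (0, 0))\<bar> \<le> H" using A[OF that] n unfolding int_mats_def by auto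
      then show ?thesis using c n unfolding Sc_def by auto
    qed
    then show "set As \<subseteq> Sc \<and> length As = s" using len by auto
  qed
  then have "card (scalar_tuples n s H) \<le> card {xs. set xs \<subseteq> Sc \<and> length xs = s}"
    by (intro card_mono finite_lists_length_eq Sc)
  also have "\<dots> = card Sc ^ s" by (rule card_lists_length_eq[OF Sc(1)])
  finally have "real (card (scalar_tuples n s H)) \<le> real (card Sc) ^ s"
    by (simp only: of_nat_power[symmetric] of_nat_le_iff)
  also have "\<dots> \<le> (3 * H) ^ s" using Sc by (intro power_mono) auto
  also have "\<dots> = 3 ^ s * H powr real s" using H by (simp add: power_mult_distrib powr_realpow)
  also have "\<dots> \<le> 3 ^ s * H powr (real s * real n ^ 2 - (real s - 1) * real n / 3 + real s * e)"
  proof (intro mult_left_mono powr_mono H)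
    have "real n * 2 \<le> real n * real n" using n by (intro mult_left_mono) auto
    then have "real n ^ 2 - real n / 3 \<ge> 1" using n unfolding power2_eq_square by linarith
    then have "real s * 1 \<le> real s * (real n ^ 2 - real n / 3)" by (intro mult_left_mono) auto
    then have "real s \<le> real s * real n ^ 2 - real s * real n / 3" by (simp add: right_diff_distrib)
    moreover have "real s * real n ^ 2 - (real s - 1) * real n / 3 + real s * e
        = (real s * real n ^ 2 - real s * real n / 3) + (real n / 3 + real s * e)"
      by (simp add: left_diff_distrib diff_divide_distrib)
    moreover have "real n / 3 + real s * e \<ge> 0" using e by simp
    ultimately show "real s \<le> real s * real n ^ 2 - (real s - 1) * real n / 3 + real s * e" by simp
  qed simp
  finally show ?thesis .
qed

section \<open>Covering the group tuples by the three families\<close>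

lemma group_tuples_subset_base: "group_tuples n s H \<subseteq> base_tuples n s H"
  unfolding group_tuples_def base_tuples_def by auto

lemma conj_entry_eq:
  assumes "A \<in> carrier_mat n n" "B \<in> carrier_mat n n" "a < n" "b < n"
  shows "conj_entry n B A a b = (A * B * adj_mat A) $$ (a, b)"
  using assms adj_mat(1)[OF assms(1)] unfolding conj_entry_def cofactor_vec_def adj_mat_def
  by (simp add: scalar_prod_def)

text \<open>Multiplying \<open>C * B * A = A * B\<close> on the right by \<open>adj_mat A\<close>
  gives \<open>A * B * adj_mat A = det A * C * B\<close>. With a denominator \<open>N\<close> of
  \<open>C\<close> prime to \<open>p\<close>, the factor \<open>p\<close> of \<open>det A\<close>
  survives on the left.\<close>

lemma prime_dvd_conj_entry:
  assumes A: "A \<in> carrier_mat n n" and B: "B \<in> carrier_mat n n" and p: "prime p" "p dvd det A"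
    and C: "p_integral p n C" "C * (rat_mat B * rat_mat A) = rat_mat A * rat_mat B"
    and ab: "a < n" "b < n"
  shows "p dvd conj_entry n B A a b"
proof -
  obtain N Y where N: "C \<in> carrier_mat n n" "\<not> p dvd N" "Y \<in> carrier_mat n n" "rat_of_int N \<cdot>\<^sub>m C = rat_mat Y"
    using C(1) unfolding p_integral_def by auto
  have adj: "adj_mat A \<in> carrier_mat n n" using adj_mat(1)[OF A] .
  have "rat_mat (Y * (B * A)) = (rat_of_int N \<cdot>\<^sub>m C) * (rat_mat B * rat_mat A)"
    unfolding N(4) using N A B by (simp add: of_int_hom.mat_hom_mult[of _ n n _ n])
  also have "\<dots> = rat_of_int N \<cdot>\<^sub>m (rat_mat A * rat_mat B)"
    using N(1) A B by (simp add: mult_smult_assoc_mat[of _ n n _ n] C(2))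
  also have "\<dots> = rat_mat (N \<cdot>\<^sub>m (A * B))"
    using A B by (subst of_int_hom.mat_hom_mult[symmetric, of _ n n _ n]) (auto intro!: eq_matI)
  finally have eq: "Y * (B * A) = N \<cdot>\<^sub>m (A * B)" by (rule of_int_hom.mat_hom_inj)
  have "N \<cdot>\<^sub>m (A * B * adj_mat A) = (Y * (B * A)) * adj_mat A"
    unfolding eq using A B adj by (simp add: mult_smult_assoc_mat[of _ n n _ n])
  also have "\<dots> = Y * ((B * A) * adj_mat A)" using N(3) A B adj by (intro assoc_mult_mat[of _ n n _ n _ n]) auto
  also have "(B * A) * adj_mat A = B * (A * adj_mat A)" using A B adj by (intro assoc_mult_mat[of _ n n _ n _ n]) auto
  also have "\<dots> = det A \<cdot>\<^sub>m B" unfolding adj_mat(2)[OF A] using B by (simp add: mult_smult_distrib[of _ n n _ n])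
  also have "Y * (det A \<cdot>\<^sub>m B) = det A \<cdot>\<^sub>m (Y * B)" using N(3) B by (simp add: mult_smult_distrib[of _ n n _ n])
  finally have "(N \<cdot>\<^sub>m (A * B * adj_mat A)) $$ (a, b) = (det A \<cdot>\<^sub>m (Y * B)) $$ (a, b)" by simp
  then have "N * conj_entry n B A a b = det A * (Y * B) $$ (a, b)"
    unfolding conj_entry_eq[OF A B ab] using N(3) A B adj ab by simp
  then have "p dvd N * conj_entry n B A a b" using p(2) by simp
  then show ?thesis using p(1) N(2) by (simp add: prime_dvd_mult_iff)
qed

text \<open>The cases are: the maximal support \<open>S\<close> is everything; it is proper and some
  matrix is not scalar; or all matrices are scalar.\<close>

lemma group_tuples_cover:
  assumes As: "As \<in> group_tuples n s H"
  shows "As \<in> scalar_tuples n s H \<or>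
    (\<exists>T\<subseteq>{..<s}. 2 * card T \<le> s \<and> As \<in> full_support_tuples n s H T) \<or>
    (\<exists>T\<subseteq>{..<s}. \<exists>i<s. 2 * card T + 1 \<le> s \<and> As \<in> partial_support_tuples n s H T i)"
proof -
  define d where "d = (\<lambda>l. det (As ! l))"
  have base: "As \<in> base_tuples n s H" using As group_tuples_subset_base by blast
  have A: "As ! l \<in> int_mats n H" "As ! l \<in> carrier_mat n n" "d l \<noteq> 0" if "l < s" for l
  proof -
    have "As ! l \<in> set As" using that base unfolding base_tuples_def by auto
    then show "As ! l \<in> int_mats n H" "As ! l \<in> carrier_mat n n" "d l \<noteq> 0"
      using base unfolding base_tuples_def int_mats_def d_def by auto
  qed
  obtain S T where S: "S \<subseteq> {..<s}" and TS: "T \<subseteq> S" and card: "2 * card T \<le> card S"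
    and primes: "\<And>l p. l \<in> S \<Longrightarrow> prime p \<Longrightarrow> p dvd d l \<Longrightarrow> p dvd (\<Prod>l\<in>T. d l)"
    and supp: "\<And>k l. mult_relation s d k \<Longrightarrow> l < s \<Longrightarrow> k l \<noteq> 0 \<Longrightarrow> l \<in> S"
    using mult_relation_core[of s d] A(3) by blast
  have T: "T \<subseteq> {..<s}" using S TS by auto
  have K: "(\<Prod>l\<in>T. d l) = det_prod T As" unfolding det_prod_def d_def by simp
  show ?thesis
  proof (cases "S = {..<s}")
    case True
    then have "As \<in> full_support_tuples n s H T"
      using base A primes[unfolded K] unfolding full_support_tuples_def det_supported_def d_def by auto
    moreover have "2 * card T \<le> s" using card True by simp
    ultimately show ?thesis using T by blast
  next
    case False
    then have "card S < s" using S psubset_card_mono[of "{..<s}" S] by auto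
    then have cT: "2 * card T + 1 \<le> s" using card by linarith
    show ?thesis
    proof (cases "\<exists>i<s. \<forall>c. As ! i \<noteq> c \<cdot>\<^sub>m 1\<^sub>m n")
      case False
      then show ?thesis using base unfolding scalar_tuples_def by auto
    next
      case True
      then obtain i where i: "i < s" "\<forall>c. As ! i \<noteq> c \<cdot>\<^sub>m 1\<^sub>m n" by blast
      \<comment> \<open>This holds for every position \<open>j\<close>, inside \<open>S\<close> or
        not: a prime of \<open>det (As ! j)\<close> either divides \<open>det_prod T As\<close> or
        is absent from all denominators of the commutator.\<close>
      have "As ! j \<in> conj_supported n H (det_prod T As) (As ! i)" if j: "j < s" for j
      proof -
        have "p dvd det_prod T As * conj_entry n (As ! i) (As ! j) a b"
          if p: "prime p" "p dvd det (As ! j)" and ab: "a < n" "b < n" for p a b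
        proof (cases "p dvd det_prod T As")
          case True then show ?thesis by simp
        next
          case False
          then have np: "\<not> p dvd det (As ! l)" if "l \<in> S" for l
            using primes[OF that p(1)] K unfolding d_def by auto
          obtain k C where kC: "mult_relation s (\<lambda>l. det (As ! l)) k" "C \<in> carrier_mat n n"
            "C * (rat_mat (As ! i) * rat_mat (As ! j)) = rat_mat (As ! j) * rat_mat (As ! i)"
            "\<And>p. prime p \<Longrightarrow> (\<And>l. l < s \<Longrightarrow> k l \<noteq> 0 \<Longrightarrow> \<not> p dvd det (As ! l)) \<Longrightarrow> p_integral p n C"
            using group_tuples_commutator[OF As i(1) j] by blast
          \<comment> \<open>The exponents of the commutator vanish outside \<open>S\<close>, and
            \<open>p\<close> divides no determinant inside \<open>S\<close>.\<close>
          have "p_integral p n C" using kC(4)[OF p(1)] np supp[of k] kC(1) unfolding d_def by blast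
          then show ?thesis
            using prime_dvd_conj_entry[OF A(2)[OF j] A(2)[OF i(1)] p _ kC(3) ab] by simp
        qed
        then show ?thesis using A[OF j] unfolding conj_supported_def d_def by auto
      qed
      then have "As \<in> partial_support_tuples n s H T i"
        using base i unfolding partial_support_tuples_def by auto
      then show ?thesis using T cT i by blast
    qed
  qed
qed

lemma card_group_tuples_le:
  fixes e :: real
  assumes e: "e > 0" and n: "n \<ge> 2" and s: "s \<ge> 1"
  shows "\<exists>C. \<forall>H\<ge>1. real (card (group_tuples n s H)) \<le>
    C * H powr (real s * real n ^ 2 - (real s - 1) * real n / 3 + e)"
proof -
  \<comment> \<open>The bounds for the families carry \<open>s * e'\<close> in the exponent, which
    this choice makes equal to \<open>e\<close>.\<close>
  define e' where "e' = e / real s"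
  have e': "e' > 0" "real s * e' = e" using e s unfolding e'_def by auto
  have n1: "n \<ge> 1" using n by simp
  define X where "X = (\<lambda>H::real. H powr (real s * real n ^ 2 - (real s - 1) * real n / 3 + e))"
  obtain C1 where C1: "C1 \<ge> 0" "\<forall>H\<ge>1. \<forall>T\<subseteq>{..<s}. 2 * card T \<le> s \<longrightarrow>
      real (card (full_support_tuples n s H T)) \<le> C1 * X H"
    using card_full_support_tuples_le[OF e'(1) n1 s] unfolding X_def e'(2) by (elim exE conjE)
  obtain C2 where C2: "C2 \<ge> 0" "\<forall>H\<ge>1. \<forall>T\<subseteq>{..<s}. \<forall>i<s. 2 * card T + 1 \<le> s \<longrightarrow>
      real (card (partial_support_tuples n s H T i)) \<le> C2 * X H"
    using card_partial_support_tuples_le[OF e'(1) n1 s] unfolding X_def e'(2) by (elim exE conjE)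
  have "real (card (group_tuples n s H)) \<le> (3 ^ s + (2 ^ s * C1 + 2 ^ s * (real s * C2))) * X H" if H: "H \<ge> 1" for H
  proof -
    define P where "P = {T. T \<subseteq> {..<s} \<and> 2 * card T \<le> s}"
    define Q where "Q = {T. T \<subseteq> {..<s} \<and> 2 * card T + 1 \<le> s}"
    have X0: "X H \<ge> 0" unfolding X_def by simp
    have sub: "P \<subseteq> Pow {..<s}" "Q \<subseteq> Pow {..<s}" unfolding P_def Q_def by auto
    then have finPQ: "finite P" "finite Q" using finite_subset by (metis finite_Pow_iff finite_lessThan)+
    have "card P \<le> 2 ^ s" "card Q \<le> 2 ^ s"
      using card_mono[OF _ sub(1)] card_mono[OF _ sub(2)] by (simp_all add: card_Pow)
    then have cPQ: "real (card P) \<le> 2 ^ s" "real (card Q) \<le> 2 ^ s"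
      using of_nat_mono[of "card P" "2 ^ s", where 'a = real] of_nat_mono[of "card Q" "2 ^ s", where 'a = real]
      by simp_all
    have "base_tuples n s H \<subseteq> {xs. set xs \<subseteq> int_mats n H \<and> length xs = s}" unfolding base_tuples_def by auto
    then have finB: "finite (base_tuples n s H)"
      using finite_lists_length_eq[OF card_int_mats(1)[OF H], of n s] finite_subset by blast
    have fin: "finite (scalar_tuples n s H)" "finite (full_support_tuples n s H T)"
      "finite (partial_support_tuples n s H T i)" for T i
      by (rule finite_subset[OF _ finB], force simp: scalar_tuples_def full_support_tuples_def partial_support_tuples_def)+
    have "group_tuples n s H \<subseteq> scalar_tuples n s H \<union>
        ((\<Union>T\<in>P. full_support_tuples n s H T) \<union> (\<Union>T\<in>Q. \<Union>i\<in>{..<s}. partial_support_tuples n s H T i))"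
    proof
      fix As assume "As \<in> group_tuples n s H"
      from group_tuples_cover[OF this] consider "As \<in> scalar_tuples n s H"
        | T where "T \<in> P" "As \<in> full_support_tuples n s H T"
        | T i where "T \<in> Q" "i \<in> {..<s}" "As \<in> partial_support_tuples n s H T i"
        unfolding P_def Q_def by auto
      then show "As \<in> scalar_tuples n s H \<union>
        ((\<Union>T\<in>P. full_support_tuples n s H T) \<union> (\<Union>T\<in>Q. \<Union>i\<in>{..<s}. partial_support_tuples n s H T i))"
        by cases (simp, blast, blast)
    qed
    then have "card (group_tuples n s H) \<le> card (scalar_tuples n s H \<union>
        ((\<Union>T\<in>P. full_support_tuples n s H T) \<union> (\<Union>T\<in>Q. \<Union>i\<in>{..<s}. partial_support_tuples n s H T i)))"
      using fin finPQ by (intro card_mono) auto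
    also have "\<dots> \<le> card (scalar_tuples n s H) + (card (\<Union>T\<in>P. full_support_tuples n s H T) +
        card (\<Union>T\<in>Q. \<Union>i\<in>{..<s}. partial_support_tuples n s H T i))"
      by (rule order_trans[OF card_Un_le add_left_mono[OF card_Un_le]])
    also have "\<dots> \<le> card (scalar_tuples n s H) + ((\<Sum>T\<in>P. card (full_support_tuples n s H T)) +
        (\<Sum>T\<in>Q. \<Sum>i<s. card (partial_support_tuples n s H T i)))"
    proof (intro add_left_mono add_mono card_UN_le finPQ)
      have "card (\<Union>T\<in>Q. \<Union>i\<in>{..<s}. partial_support_tuples n s H T i)
          \<le> (\<Sum>T\<in>Q. card (\<Union>i\<in>{..<s}. partial_support_tuples n s H T i))" by (rule card_UN_le[OF finPQ(2)])
      also have "\<dots> \<le> (\<Sum>T\<in>Q. \<Sum>i<s. card (partial_support_tuples n s H T i))" by (intro sum_mono card_UN_le) simp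
      finally show "card (\<Union>T\<in>Q. \<Union>i\<in>{..<s}. partial_support_tuples n s H T i)
          \<le> (\<Sum>T\<in>Q. \<Sum>i<s. card (partial_support_tuples n s H T i))" .
    qed
    finally have "real (card (group_tuples n s H)) \<le> real (card (scalar_tuples n s H) + ((\<Sum>T\<in>P. card (full_support_tuples n s H T)) +
        (\<Sum>T\<in>Q. \<Sum>i<s. card (partial_support_tuples n s H T i))))" by (simp only: of_nat_le_iff)
    also have "\<dots> = real (card (scalar_tuples n s H)) + ((\<Sum>T\<in>P. real (card (full_support_tuples n s H T))) +
        (\<Sum>T\<in>Q. \<Sum>i<s. real (card (partial_support_tuples n s H T i))))" by simp
    also have "\<dots> \<le> 3 ^ s * X H + ((\<Sum>T\<in>P. C1 * X H) + (\<Sum>T\<in>Q. \<Sum>i<s. C2 * X H))"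
    proof (intro add_mono sum_mono)
      show "real (card (scalar_tuples n s H)) \<le> 3 ^ s * X H"
        using card_scalar_tuples_le[OF n H _ s, of e'] e' unfolding X_def by simp
    qed (use C1(2) C2(2) H in \<open>auto simp: P_def Q_def\<close>)
    also have "\<dots> = 3 ^ s * X H + (real (card P) * (C1 * X H) + real (card Q) * (real s * (C2 * X H)))" by simp
    also have "\<dots> \<le> 3 ^ s * X H + (2 ^ s * (C1 * X H) + 2 ^ s * (real s * (C2 * X H)))"
      using cPQ C1(1) C2(1) X0 by (intro add_left_mono add_mono mult_right_mono) auto
    also have "\<dots> = (3 ^ s + (2 ^ s * C1 + 2 ^ s * (real s * C2))) * X H" by (simp add: algebra_simps)
    finally show ?thesis .
  qed
  then show ?thesis unfolding X_def by (intro exI allI impI)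
qed

section \<open>From an arbitrary positive loss to a vanishing one\<close>

text \<open>Constants depending on \<open>e\<close> are absorbed by a further small power of
  \<open>H\<close>, so the actual excess of the exponent of \<open>f H\<close> over \<open>a\<close>
  is eventually below every positive number.\<close>

lemma exists_vanishing_exponent:
  fixes f :: "real \<Rightarrow> real" and a :: real
  assumes nonneg: "\<And>H. f H \<ge> 0" and bound: "\<And>e. e > 0 \<Longrightarrow> \<exists>C. \<forall>H\<ge>1. f H \<le> C * H powr (a + e)"
  shows "\<exists>\<delta> :: real \<Rightarrow> real. (\<delta> \<longlongrightarrow> 0) at_top \<and> (\<forall>\<^sub>F H in at_top. f H \<le> H powr (a + \<delta> H))"
proof -
  \<comment> \<open>The excess itself, with value 0 when \<open>f H\<close> vanishes and has no
    logarithm. The cut at 0 reduces convergence to upper bounds.\<close>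
  define \<delta> where "\<delta> = (\<lambda>H. if f H = 0 then 0 else max 0 (log H (f H) - a))"
  have ge: "f H \<le> H powr (a + \<delta> H)" if H: "H > 1" for H
  proof (cases "f H = 0")
    case True then show ?thesis using H by simp
  next
    case False
    then have pos: "f H > 0" using nonneg[of H] by simp
    have "f H = H powr log H (f H)" using H pos by simp
    also have "\<dots> \<le> H powr (a + \<delta> H)" using H False unfolding \<delta>_def by (intro powr_mono) auto
    finally show ?thesis .
  qed
  have small: "\<forall>\<^sub>F H in at_top. \<delta> H \<le> e" if e: "e > 0" for e
  proof -
    obtain C where C: "\<And>H. H \<ge> 1 \<Longrightarrow> f H \<le> C * H powr (a + e / 2)" using bound[of "e / 2"] e by auto
    \<comment> \<open>Beyond this threshold \<open>H powr (e / 2)\<close> exceeds \<open>C\<close>,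
      so half of \<open>e\<close> swallows the constant.\<close>
    have "\<forall>\<^sub>F H in at_top. H \<ge> max 2 (\<bar>C\<bar> + 1) powr (2 / e)" by (rule eventually_ge_at_top)
    moreover have "\<forall>\<^sub>F H in at_top. H > (1::real)" by (rule eventually_gt_at_top)
    ultimately show ?thesis
    proof eventually_elim
      case (elim H)
      show ?case
      proof (cases "f H = 0")
        case True then show ?thesis using e unfolding \<delta>_def by simp
      next
        case False
        then have pos: "f H > 0" using nonneg[of H] by simp
        have "C \<le> max 2 (\<bar>C\<bar> + 1)" by simp
        also have "max 2 (\<bar>C\<bar> + 1) = (max 2 (\<bar>C\<bar> + 1) powr (2 / e)) powr (e / 2)"
          using e by (simp add: powr_powr)
        also have "\<dots> \<le> H powr (e / 2)" using elim(1) e by (intro powr_mono2) auto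
        finally have "C * H powr (a + e / 2) \<le> H powr (e / 2) * H powr (a + e / 2)" by (intro mult_right_mono) auto
        also have "\<dots> = H powr (a + e)" by (simp add: powr_add[symmetric] add.commute add.left_commute)
        finally have "f H \<le> H powr (a + e)" using C[of H] elim(2) by simp
        then have "log H (f H) \<le> a + e" using pos elim(2) by (simp add: log_le_iff)
        then show ?thesis using False e unfolding \<delta>_def by simp
      qed
    qed
  qed
  have "(\<delta> \<longlongrightarrow> 0) at_top"
  proof (rule tendstoI)
    fix e :: real assume "e > 0"
    then have "\<forall>\<^sub>F H in at_top. \<delta> H \<le> e / 2" using small[of "e / 2"] by simp
    then show "\<forall>\<^sub>F H in at_top. dist (\<delta> H) 0 < e"
    proof eventually_elim
      case (elim H)
      have "\<delta> H \<ge> 0" unfolding \<delta>_def by simp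
      then show ?case using elim \<open>e > 0\<close> by simp
    qed
  qed
  moreover have "\<forall>\<^sub>F H in at_top. f H \<le> H powr (a + \<delta> H)"
    using eventually_gt_at_top[of "1::real"] by eventually_elim (rule ge)
  ultimately show ?thesis by blast
qed

theorem theorem2p9:
  fixes n s :: nat
  assumes "n \<ge> 2" and "s \<ge> 1"
  shows "\<exists>\<delta> :: real \<Rightarrow> real. (\<delta> \<longlongrightarrow> 0) at_top \<and>
    (\<forall>\<^sub>F H in at_top.
       real (card (group_tuples n s H)) \<le>
         H powr (real s * real n ^ 2 - (real s - 1) * real n / 3 + \<delta> H))"
  using card_group_tuples_le[OF _ assms] by (intro exists_vanishing_exponent) auto

end
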